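(* Let $U:\mathbb{R}^d\to\mathbb{R}$ be continuously differentiable, and let $L\ge 0$, $m>0$ be such that for all $x,y\in\mathbb{R}^d$, $\|\nabla U(x)-\nabla U(y)\|\le L\|x-y\|$ and $U(y)\ge U(x)+\langle\nabla U(x),y-x\rangle+(m/2)\|x-y\|^2$. Let $(\gamma_k)_{k\ge1}$ be a non-increasing sequence of positive real numbers with $\gamma_1\le 1/(m+L)$. Then for all $x\in\mathbb{R}^d$ and $n\ge 1$, $$W_2^2(\delta_xQ_\gamma^n,\pi)\le u_n^{(1)}(\gamma)\left\{\|x-x^\star\|^2+d/m\right\}+u_n^{(2)}(\gamma),$$ where $$u_n^{(1)}(\gamma)=2\prod_{k=1}^n(1-\kappa\gamma_k/2),$$ $$u_n^{(2)}(\gamma)=L^2d\sum_{i=1}^n\left[\gamma_i^2\left\{\kappa^{-1}+\gamma_i\right\}\left\{2+\frac{L^2\gamma_i}{m}+\frac{L^2\gamma_i^2}{6}\right\}\prod_{k=i+1}^n(1-\kappa\gamma_k/2)\right].$$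
   Context: Here $d\ge1$, $\|\cdot\|$ is the Euclidean norm, and empty products equal $1$. $x^\star$ denotes the unique minimizer of $U$ (it exists by strong convexity), $\kappa=2mL/(m+L)$, and $\pi$ is the probability measure on $\mathbb{R}^d$ with density proportional to $e^{-U}$. For $\gamma>0$, $R_\gamma$ is the Markov kernel on $\mathbb{R}^d$ such that $R_\gamma(x,\cdot)$ is the Gaussian distribution with mean $x-\gamma\nabla U(x)$ and covariance matrix $2\gamma I_d$ (one step of the unadjusted Langevin algorithm). $Q_\gamma^n=R_{\gamma_1}R_{\gamma_2}\cdots R_{\gamma_n}$, so $\delta_xQ_\gamma^n$ is the law of the $n$-th iterate of $X_{k+1}=X_k-\gamma_{k+1}\nabla U(X_k)+\sqrt{2\gamma_{k+1}}Z_{k+1}$, $X_0=x$, with $(Z_k)$ i.i.d. standard $d$-dimensional Gaussian. $W_2$ is the Wasserstein distance of order $2$: $W_2(\mu,\nu)=\big(\inf_\zeta\int\|x-y\|^2d\zeta(x,y)\big)^{1/2}$ over couplings $\zeta$ of $\mu,\nu$. *)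

theory Defs
  imports "HOL-Probability.Probability"
begin

definition couplings ::
  "'a::euclidean_space measure \<Rightarrow> 'a measure \<Rightarrow> ('a \<times> 'a) measure set" where
  "couplings \<mu> \<nu> =
     {\<zeta>. sets \<zeta> = sets (borel \<Otimes>\<^sub>M borel) \<and> distr \<zeta> borel fst = \<mu> \<and> distr \<zeta> borel snd = \<nu>}"

text \<open>Extended square root: the transport cost below may be infinite, and then so is its root.\<close>

definition ennreal_sqrt :: "ennreal \<Rightarrow> ennreal" where
  "ennreal_sqrt c = (if c = \<infinity> then \<infinity> else ennreal (sqrt (enn2real c)))"

definition wasserstein2 :: "'a::euclidean_space measure \<Rightarrow> 'a measure \<Rightarrow> ennreal" where
  "wasserstein2 \<mu> \<nu> =
     ennreal_sqrt (INF \<zeta>\<in>couplings \<mu> \<nu>. \<integral>\<^sup>+ (x, y). ennreal ((norm (x - y))\<^sup>2) \<partial>\<zeta>)"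

text \<open>The Gaussian distribution with mean \<open>a\<close> and covariance matrix \<open>v\<close> times the identity.\<close>

definition gaussian :: "'a::euclidean_space \<Rightarrow> real \<Rightarrow> 'a measure" where
  "gaussian a v = density lborel
     (\<lambda>y. ennreal ((2 * pi * v) powr (- (real DIM('a) / 2)) * exp (- (norm (y - a))\<^sup>2 / (2 * v))))"

text \<open>\<open>G\<close> stands for the gradient of the potential.\<close>

definition ula_step :: "('a::euclidean_space \<Rightarrow> 'a) \<Rightarrow> real \<Rightarrow> 'a \<Rightarrow> 'a measure" where
  "ula_step G h x = gaussian (x - h *\<^sub>R G x) (2 * h)"

text \<open>Step sizes are indexed from 1; the value \<open>\<gamma> 0\<close> is never used.\<close>

primrec ula_kernel ::
  "('a::euclidean_space \<Rightarrow> 'a) \<Rightarrow> (nat \<Rightarrow> real) \<Rightarrow> nat \<Rightarrow> 'a \<Rightarrow> 'a measure" where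
  "ula_kernel G \<gamma> 0 x = return borel x"
| "ula_kernel G \<gamma> (Suc n) x = ula_kernel G \<gamma> n x \<bind> ula_step G (\<gamma> (Suc n))"

definition gibbs :: "('a::euclidean_space \<Rightarrow> real) \<Rightarrow> 'a measure" where
  "gibbs U = density lborel (\<lambda>x. ennreal (exp (- U x) / (\<integral>y. exp (- U y) \<partial>lborel)))"

definition minimizer :: "('a \<Rightarrow> real) \<Rightarrow> 'a" where
  "minimizer U = (THE z. is_arg_min U (\<lambda>_. True) z)"

definition kappa :: "real \<Rightarrow> real \<Rightarrow> real" where
  "kappa m L = 2 * m * L / (m + L)"

definition u1 :: "real \<Rightarrow> real \<Rightarrow> (nat \<Rightarrow> real) \<Rightarrow> nat \<Rightarrow> real" where
  "u1 m L \<gamma> n = 2 * (\<Prod>k=1..n. 1 - kappa m L * \<gamma> k / 2)"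

definition u2 :: "nat \<Rightarrow> real \<Rightarrow> real \<Rightarrow> (nat \<Rightarrow> real) \<Rightarrow> nat \<Rightarrow> real" where
  "u2 d m L \<gamma> n = L\<^sup>2 * real d *
     (\<Sum>i=1..n. (\<gamma> i)\<^sup>2 * (inverse (kappa m L) + \<gamma> i) *
        (2 + L\<^sup>2 * \<gamma> i / m + L\<^sup>2 * (\<gamma> i)\<^sup>2 / 6) *
        (\<Prod>k=i+1..n. 1 - kappa m L * \<gamma> k / 2))"

end

theory Submission
  imports Defs
begin

text \<open>No stochastic calculus is used: in place of the Langevin diffusion, a random-walk Metropolis
  chain with proposals \<open>y + s z\<close> (\<open>z\<close> standard Gaussian) leaves \<open>\<pi>\<close> exactly invariant. One Langevin
  step from \<open>X\<close> is a gradient step followed by a Gaussian increment of variance \<open>2\<gamma>\<close>; the increment is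
  split into \<open>N\<close> pieces of variance \<open>s\<^sup>2 = 2\<gamma> / N\<close>, which are also the proposals of a Metropolis chain
  \<open>Y\<close> started from \<open>\<pi>\<close>. The difference \<open>X - Y\<close> moves only at rejections, whose mean effect is
  \<open>s\<^sup>2/2 \<nabla>U(Y) + O(s\<^sup>3)\<close>, so by convexity \<open>E|X - Y|\<^sup>2\<close> grows by at most \<open>s\<^sup>2 E(U(X) - U(Y)) + O(s\<^sup>3)\<close>. The
  gradient step decreases \<open>|X - Y|\<^sup>2\<close> to \<open>(1 - m\<gamma>)|X - Y|\<^sup>2 - 2\<gamma>(U(X') - U(Y))\<close>, where \<open>X'\<close> is the new point,
  and \<open>E U\<close> grows by at most \<open>L d s\<^sup>2/2\<close> per Gaussian increment. Summing and letting \<open>N \<rightarrow> \<infinity>\<close> gives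
  \<open>W\<^sub>2\<^sup>2(\<mu>R\<^sub>\<gamma>, \<pi>) \<le> (1 - m\<gamma>) W\<^sub>2\<^sup>2(\<mu>, \<pi>) + L d \<gamma>\<^sup>2\<close>, which is stronger than the recursion defining
  \<open>u\<^sup>(\<^sup>1\<^sup>)\<close> and \<open>u\<^sup>(\<^sup>2\<^sup>)\<close> because \<open>\<kappa>/2 \<le> m\<close> and \<open>L \<le> 2 L\<^sup>2/\<kappa>\<close>.\<close>

section \<open>Gaussian measures\<close>

lemma nn_integral_lborel_affine:
  fixes f :: "'a::euclidean_space \<Rightarrow> ennreal"
  assumes [measurable]: "f \<in> borel_measurable borel" and c: "c \<noteq> 0"
  shows "(\<integral>\<^sup>+x. f x \<partial>lborel) = ennreal (\<bar>c\<bar> ^ DIM('a)) * (\<integral>\<^sup>+x. f (t + c *\<^sub>R x) \<partial>lborel)"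
  by (subst lborel_affine[OF c, of t])
     (simp add: nn_integral_density nn_integral_distr nn_integral_cmult)

lemma nn_integral_lborel_shift:
  fixes f :: "'a::euclidean_space \<Rightarrow> ennreal"
  assumes "f \<in> borel_measurable borel"
  shows "(\<integral>\<^sup>+x. f (x + t) \<partial>lborel) = (\<integral>\<^sup>+x. f x \<partial>lborel)"
  using nn_integral_lborel_affine[OF assms, of 1 t] by (simp add: add.commute)

lemma nn_integral_lborel_uminus:
  fixes f :: "'a::euclidean_space \<Rightarrow> ennreal"
  assumes "f \<in> borel_measurable borel"
  shows "(\<integral>\<^sup>+x. f (- x) \<partial>lborel) = (\<integral>\<^sup>+x. f x \<partial>lborel)"
  using nn_integral_lborel_affine[OF assms, of "-1" 0] by simp

section \<open>Gaussian densities: normalisation, convolution and scaling\<close>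

definition gaussian_density :: "real \<Rightarrow> 'a::euclidean_space \<Rightarrow> real" where
  "gaussian_density v z =
     (2 * pi * v) powr (- (real DIM('a) / 2)) * exp (- (norm z)\<^sup>2 / (2 * v))"

lemma gaussian_density_measurable [measurable]: "gaussian_density v \<in> borel_measurable borel"
  unfolding gaussian_density_def[abs_def] by measurable

lemma gaussian_density_nonneg [simp]: "0 \<le> gaussian_density v z"
  by (simp add: gaussian_density_def)

lemma gaussian_density_minus [simp]: "gaussian_density v (- z) = gaussian_density v z"
  by (simp add: gaussian_density_def)

lemma gaussian_eq: "gaussian a v = density lborel (\<lambda>y. ennreal (gaussian_density v (y - a)))"
  by (simp add: gaussian_def gaussian_density_def)

lemma sets_gaussian [simp, measurable_cong]: "sets (gaussian a v) = sets borel"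
  by (simp add: gaussian_def)

lemma space_gaussian [simp]: "space (gaussian a v) = UNIV"
  by (simp add: gaussian_def)

text \<open>Translation by the mean. The weight left over is centred, so Fubini and the symmetries
  of \<open>lborel\<close> can act on it directly.\<close>

lemma nn_integral_gaussian:
  assumes [measurable]: "f \<in> borel_measurable borel"
  shows "(\<integral>\<^sup>+y. f y \<partial>gaussian a v) = (\<integral>\<^sup>+z. ennreal (gaussian_density v z) * f (a + z) \<partial>lborel)"
proof -
  have "(\<integral>\<^sup>+y. f y \<partial>gaussian a v) = (\<integral>\<^sup>+y. ennreal (gaussian_density v (y - a)) * f y \<partial>lborel)"
    by (simp add: gaussian_eq nn_integral_density)
  also have "\<dots> = (\<integral>\<^sup>+y. ennreal (gaussian_density v (y + a - a)) * f (y + a) \<partial>lborel)"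
    by (rule nn_integral_lborel_shift[symmetric]) measurable
  finally show ?thesis by (simp add: add.commute)
qed

text \<open>The squared norm is the sum of the squared coordinates, so the weight splits over the
  basis and its integrals reduce to dimension one.\<close>

lemma exp_norm_eq_prod:
  fixes z :: "'a::euclidean_space"
  shows "exp (- (norm z)\<^sup>2 / (2 * v)) = (\<Prod>b\<in>Basis. exp (- (z \<bullet> b)\<^sup>2 / (2 * v)))"
proof -
  have "(norm z)\<^sup>2 = (\<Sum>b\<in>Basis. (z \<bullet> b)\<^sup>2)"
    unfolding power2_norm_eq_inner by (subst euclidean_inner) (simp only: power2_eq_square)
  then show ?thesis
    by (simp only: exp_sum[OF finite_Basis, symmetric] sum_negf sum_divide_distrib minus_divide_left[symmetric])
qed

lemma nn_integral_exp_square: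
  assumes "v > 0"
  shows "(\<integral>\<^sup>+x. ennreal (exp (- x\<^sup>2 / (2 * v))) \<partial>lborel) = ennreal (sqrt (2 * pi * v))"
proof -
  have "(\<integral>\<^sup>+x. ennreal (exp (- x\<^sup>2 / (2 * v))) \<partial>lborel)
      = (\<integral>\<^sup>+x. ennreal (sqrt (2 * pi * v)) * ennreal (normal_density 0 (sqrt v) x) \<partial>lborel)"
    using assms by (intro nn_integral_cong) (simp add: normal_density_def flip: ennreal_mult)
  also have "\<dots> = ennreal (sqrt (2 * pi * v)) * (\<integral>\<^sup>+x. ennreal (normal_density 0 (sqrt v) x) \<partial>lborel)"
    by (simp add: nn_integral_cmult)
  also have "(\<integral>\<^sup>+x. ennreal (normal_density 0 (sqrt v) x) \<partial>lborel) = 1"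
    using assms by (subst nn_integral_eq_integral) auto
  finally show ?thesis by simp
qed

lemma nn_integral_exp_norm_square:
  assumes v: "v > 0"
  shows "(\<integral>\<^sup>+z. ennreal (exp (- (norm (z::'a::euclidean_space))\<^sup>2 / (2 * v))) \<partial>lborel)
    = ennreal ((2 * pi * v) powr (real DIM('a) / 2))"
proof -
  have "(\<integral>\<^sup>+z. ennreal (exp (- (norm (z::'a))\<^sup>2 / (2 * v))) \<partial>lborel)
      = (\<integral>\<^sup>+z. (\<Prod>b\<in>Basis. ennreal (exp (- (z \<bullet> b)\<^sup>2 / (2 * v)))) \<partial>(lborel :: 'a measure))"
    by (simp only: exp_norm_eq_prod prod_ennreal[OF exp_ge_zero])
  also have "\<dots> = (\<Prod>b\<in>(Basis :: 'a set). \<integral>\<^sup>+x. ennreal (exp (- x\<^sup>2 / (2 * v))) \<partial>lborel)"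
    by (rule nn_integral_lborel_prod) auto
  also have "\<dots> = ennreal (sqrt (2 * pi * v) ^ DIM('a))"
    by (simp only: nn_integral_exp_square[OF v] prod_constant) (use v in \<open>simp add: ennreal_power\<close>)
  also have "sqrt (2 * pi * v) ^ DIM('a) = (2 * pi * v) powr (real DIM('a) / 2)"
    using v by (simp add: powr_half_sqrt[symmetric] powr_realpow[symmetric] powr_powr)
  finally show ?thesis .
qed

lemma nn_integral_gaussian_density:
  assumes v: "v > 0"
  shows "(\<integral>\<^sup>+z. ennreal (gaussian_density v (z::'a::euclidean_space)) \<partial>lborel) = 1"
proof -
  have "(\<integral>\<^sup>+z. ennreal (gaussian_density v (z::'a)) \<partial>lborel)
    = ennreal ((2 * pi * v) powr (- (real DIM('a) / 2))) *
      (\<integral>\<^sup>+z. ennreal (exp (- (norm (z::'a))\<^sup>2 / (2 * v))) \<partial>lborel)"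
    by (simp add: gaussian_density_def ennreal_mult nn_integral_cmult)
  also have "\<dots> = 1"
    using v by (subst nn_integral_exp_norm_square)
      (auto simp flip: ennreal_mult simp: powr_add[symmetric])
  finally show ?thesis .
qed

lemma prob_space_gaussian: "v > 0 \<Longrightarrow> prob_space (gaussian a v)"
  by (rule prob_spaceI)
     (use nn_integral_gaussian[of "\<lambda>_. 1" a v] nn_integral_gaussian_density[of v] in simp)

text \<open>Completing the square: \<open>gaussian_density v (y - z) * gaussian_density w z\<close> is, as a function
  of \<open>z\<close>, a multiple of a Gaussian density of variance \<open>v * w / (v + w)\<close>.\<close>

lemma gaussian_density_mult:
  fixes y z :: "'a::euclidean_space"
  assumes v: "v > 0" and w: "w > 0"
  shows "gaussian_density v (y - z) * gaussian_density w z
    = gaussian_density (v + w) y * gaussian_density (v * w / (v + w)) (z - (w / (v + w)) *\<^sub>R y)"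
proof -
  let ?d = "- (real DIM('a) / 2)"
  have "(2 * pi * v) powr ?d * (2 * pi * w) powr ?d
      = ((2 * pi * v) * (2 * pi * w)) powr ?d"
    using v w by (subst powr_mult) auto
  \<comment> \<open>The normalising constants match because \<open>v + w\<close> times the variance
    \<open>v * w / (v + w)\<close> is \<open>v * w\<close>.\<close>
  also have "(2 * pi * v) * (2 * pi * w) = (2 * pi * (v + w)) * (2 * pi * (v * w / (v + w)))"
    using v w by (simp add: field_simps)
  also have "\<dots> powr ?d = (2 * pi * (v + w)) powr ?d * (2 * pi * (v * w / (v + w))) powr ?d"
    using v w by (subst powr_mult) auto
  finally have const: "(2 * pi * v) powr ?d * (2 * pi * w) powr ?d
      = (2 * pi * (v + w)) powr ?d * (2 * pi * (v * w / (v + w))) powr ?d" .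
  have expand: "(norm (y - z))\<^sup>2 = (norm y)\<^sup>2 - 2 * (y \<bullet> z) + (norm z)\<^sup>2"
    "(norm (z - (w / (v + w)) *\<^sub>R y))\<^sup>2
      = (norm z)\<^sup>2 - 2 * (w / (v + w)) * (y \<bullet> z) + (w / (v + w))\<^sup>2 * (norm y)\<^sup>2"
    unfolding power2_norm_eq_inner
    by (simp_all add: inner_diff_left inner_diff_right inner_commute power2_eq_square algebra_simps)
  define A B C where "A = (norm y)\<^sup>2" and "B = y \<bullet> z" and "C = (norm z)\<^sup>2"
  define r iu where "r = w / (v + w)" and "iu = inverse (2 * (v * w / (v + w)))"
  have "v + w > 0" using v w by simp
  then have "v + w \<noteq> 0" "v \<noteq> 0" "w \<noteq> 0" using v w by auto
  \<comment> \<open>These identities hold all the division. With them the completion of the square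
    below is ring algebra, the inverses being treated as atoms.\<close>
  then have r: "inverse (2 * v) + inverse (2 * w) = iu" "r * iu = inverse (2 * v)"
    "inverse (2 * v) = inverse (2 * (v + w)) + r * inverse (2 * v)"
    unfolding r_def iu_def by (simp_all add: divide_simps) (simp_all add: algebra_simps)
  have "(A - 2 * B + C) * inverse (2 * v) + C * inverse (2 * w)
      = A * inverse (2 * v) - 2 * B * inverse (2 * v) + C * (inverse (2 * v) + inverse (2 * w))"
    by (simp only: algebra_simps)
  also have "\<dots> = A * (inverse (2 * (v + w)) + r * (r * iu)) - 2 * B * (r * iu) + C * iu"
    by (simp only: r(1,2) r(3)[symmetric])
  also have "\<dots> = A * inverse (2 * (v + w)) + (C - 2 * r * B + r\<^sup>2 * A) * iu"
    by (simp only: algebra_simps power2_eq_square)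
  finally have "(A - 2 * B + C) * inverse (2 * v) + C * inverse (2 * w) =
      A * inverse (2 * (v + w)) + (C - 2 * r * B + r\<^sup>2 * A) * iu" .
  then have "- (norm (y - z))\<^sup>2 / (2 * v) + - (norm z)\<^sup>2 / (2 * w)
     = - (norm y)\<^sup>2 / (2 * (v + w))
       + - (norm (z - (w / (v + w)) *\<^sub>R y))\<^sup>2 / (2 * (v * w / (v + w)))"
    unfolding expand unfolding A_def B_def C_def r_def iu_def divide_inverse by (simp only: minus_mult_left[symmetric] minus_add_distrib[symmetric])
  then have "exp (- (norm (y - z))\<^sup>2 / (2 * v)) * exp (- (norm z)\<^sup>2 / (2 * w))
     = exp (- (norm y)\<^sup>2 / (2 * (v + w)))
       * exp (- (norm (z - (w / (v + w)) *\<^sub>R y))\<^sup>2 / (2 * (v * w / (v + w))))"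
    by (simp only: exp_add[symmetric])
  then show ?thesis
    unfolding gaussian_density_def using const
    by (simp only: mult.assoc mult.left_commute[of "exp _"]) (simp only: mult.assoc[symmetric])
qed

text \<open>After the sum is taken as the new variable \<open>y\<close>, the product of the two
  densities factors into the density of \<open>y\<close> and the conditional density of
  \<open>z\<close> given \<open>y\<close>, which integrates to 1. Iterated, this merges many small
  increments into one.\<close>

lemma nn_integral_gaussian_add:
  fixes f :: "'a::euclidean_space \<Rightarrow> ennreal"
  assumes v: "v > 0" and w: "w > 0" and [measurable]: "f \<in> borel_measurable borel"
  shows "(\<integral>\<^sup>+z. \<integral>\<^sup>+y. f (z + y) \<partial>gaussian 0 v \<partial>gaussian 0 w) = (\<integral>\<^sup>+y. f y \<partial>gaussian 0 (v + w))"
proof -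
  have "(\<integral>\<^sup>+z. \<integral>\<^sup>+y. f (z + y) \<partial>gaussian 0 v \<partial>gaussian 0 w)
    = (\<integral>\<^sup>+z. \<integral>\<^sup>+y. ennreal (gaussian_density w z) * (ennreal (gaussian_density v y) * f (z + y)) \<partial>lborel \<partial>lborel)"
    by (simp add: nn_integral_gaussian nn_integral_cmult)
  also have "\<dots> = (\<integral>\<^sup>+z. \<integral>\<^sup>+y. ennreal (gaussian_density w z) * (ennreal (gaussian_density v (y + - z)) * f (z + (y + -z))) \<partial>lborel \<partial>lborel)"
    by (intro nn_integral_cong nn_integral_lborel_shift[symmetric]) measurable
  also have "\<dots> = (\<integral>\<^sup>+z. \<integral>\<^sup>+y. ennreal (gaussian_density (v + w) y) * f y *
      ennreal (gaussian_density (v * w / (v + w)) (z - (w / (v + w)) *\<^sub>R y)) \<partial>lborel \<partial>lborel)"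
  proof (intro nn_integral_cong)
    fix z y :: 'a
    have "ennreal (gaussian_density w z) * ennreal (gaussian_density v (y + - z)) =
       ennreal (gaussian_density (v + w) y) *
       ennreal (gaussian_density (v * w / (v + w)) (z - (w / (v + w)) *\<^sub>R y))"
      using gaussian_density_mult[OF v w, of y z] by (simp add: mult.commute flip: ennreal_mult)
    then show "ennreal (gaussian_density w z) * (ennreal (gaussian_density v (y + - z)) * f (z + (y + -z)))
       = ennreal (gaussian_density (v + w) y) * f y *
      ennreal (gaussian_density (v * w / (v + w)) (z - (w / (v + w)) *\<^sub>R y))"
      by (simp add: mult_ac)
  qed
  also have "\<dots> = (\<integral>\<^sup>+y. \<integral>\<^sup>+z. ennreal (gaussian_density (v + w) y) * f y *
      ennreal (gaussian_density (v * w / (v + w)) (z - (w / (v + w)) *\<^sub>R y)) \<partial>lborel \<partial>lborel)"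
    by (rule lborel_pair.Fubini') measurable
  also have "\<dots> = (\<integral>\<^sup>+y. ennreal (gaussian_density (v + w) y) * f y \<partial>lborel)"
  proof (intro nn_integral_cong)
    fix y :: 'a
    have "(\<integral>\<^sup>+z. ennreal (gaussian_density (v * w / (v + w)) (z - (w / (v + w)) *\<^sub>R y)) \<partial>lborel) = 1"
      using nn_integral_lborel_shift[of "\<lambda>z. ennreal (gaussian_density (v * w / (v + w)) z)"
          "- (w / (v + w)) *\<^sub>R y"] nn_integral_gaussian_density[of "v * w / (v + w)"] v w by simp
    then show "(\<integral>\<^sup>+z. ennreal (gaussian_density (v + w) y) * f y *
      ennreal (gaussian_density (v * w / (v + w)) (z - (w / (v + w)) *\<^sub>R y)) \<partial>lborel)
      = ennreal (gaussian_density (v + w) y) * f y"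
      by (simp add: nn_integral_cmult)
  qed
  also have "\<dots> = (\<integral>\<^sup>+y. f y \<partial>gaussian 0 (v + w))"
    by (simp add: nn_integral_gaussian)
  finally show ?thesis .
qed

text \<open>The Jacobian \<open>s ^ DIM('a)\<close> cancels against the normalising constant of
  variance \<open>s\<^sup>2\<close>. Standard Gaussian noise can thus drive increments of every
  size.\<close>

lemma nn_integral_gaussian_scale:
  fixes f :: "'a::euclidean_space \<Rightarrow> ennreal"
  assumes s: "s > 0" and [measurable]: "f \<in> borel_measurable borel"
  shows "(\<integral>\<^sup>+z. f (s *\<^sub>R z) \<partial>gaussian 0 1) = (\<integral>\<^sup>+z. f z \<partial>gaussian 0 (s\<^sup>2))"
proof -
  have dens: "ennreal (s ^ DIM('a)) * ennreal (gaussian_density (s\<^sup>2) (s *\<^sub>R z)) = ennreal (gaussian_density 1 z)"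
    for z :: 'a
  proof -
    have "(s\<^sup>2) powr (real DIM('a) / 2) = s ^ DIM('a)"
      using s powr_realpow[of s 2] powr_realpow[of s "DIM('a)"] powr_powr[of s 2 "real DIM('a) / 2"] by simp
    moreover have "(2 * pi * s\<^sup>2) powr (- (real DIM('a) / 2))
        = (2 * pi) powr (- (real DIM('a) / 2)) * (s\<^sup>2) powr (- (real DIM('a) / 2))"
      by (rule powr_mult)
    ultimately have const: "s ^ DIM('a) * (2 * pi * s\<^sup>2) powr (- (real DIM('a) / 2))
        = (2 * pi) powr (- (real DIM('a) / 2))"
      using s by (simp add: powr_minus field_simps)
    have "s ^ DIM('a) * gaussian_density (s\<^sup>2) (s *\<^sub>R z) = gaussian_density 1 z"
      unfolding gaussian_density_def mult.assoc[symmetric] const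
      using s by (simp add: power_mult_distrib)
    then show ?thesis
      using s by (simp flip: ennreal_mult)
  qed
  have "(\<integral>\<^sup>+z. f z \<partial>gaussian 0 (s\<^sup>2)) = (\<integral>\<^sup>+z. ennreal (gaussian_density (s\<^sup>2) z) * f z \<partial>lborel)"
    by (simp add: nn_integral_gaussian)
  also have "\<dots> = ennreal (s ^ DIM('a)) *
      (\<integral>\<^sup>+z. ennreal (gaussian_density (s\<^sup>2) (s *\<^sub>R z)) * f (s *\<^sub>R z) \<partial>lborel)"
    using s by (subst nn_integral_lborel_affine[of _ s 0]) auto
  also have "\<dots> = (\<integral>\<^sup>+z. ennreal (gaussian_density 1 z) * f (s *\<^sub>R z) \<partial>lborel)"
    by (simp add: dens[symmetric] nn_integral_cmult mult.assoc)
  finally show ?thesis by (simp add: nn_integral_gaussian)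
qed

section \<open>Moments of the standard Gaussian\<close>

lemma pow4_exp_le:
  fixes r c :: real
  assumes "c > 0"
  shows "r ^ 4 * exp (- c * r\<^sup>2) \<le> 8 / c\<^sup>2 * exp (- (c / 2) * r\<^sup>2)"
proof -
  \<comment> \<open>The quadratic Taylor term alone beats the fourth power, at the price of half of
    the exponential decay.\<close>
  have "(c * r\<^sup>2 / 2)\<^sup>2 / 2 \<le> exp (c * r\<^sup>2 / 2)"
  proof -
    have "0 \<le> c * r\<^sup>2 / 2" using assms by simp
    then show ?thesis using exp_lower_Taylor_quadratic[of "c * r\<^sup>2 / 2"] by linarith
  qed
  then have "r ^ 4 \<le> 8 / c\<^sup>2 * exp (c * r\<^sup>2 / 2)"
    using assms by (simp add: field_simps power_mult_distrib power_divide flip: power_mult)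
  then have "r ^ 4 * exp (- c * r\<^sup>2) \<le> 8 / c\<^sup>2 * exp (c * r\<^sup>2 / 2) * exp (- c * r\<^sup>2)"
    by (rule mult_right_mono) simp
  also have "\<dots> = 8 / c\<^sup>2 * exp (- (c / 2) * r\<^sup>2)"
    by (simp add: mult.assoc flip: exp_add)
  finally show ?thesis .
qed

lemma nn_integral_exp_norm_finite:
  fixes c :: real
  assumes "c > 0"
  shows "(\<integral>\<^sup>+z. ennreal (exp (- c * (norm (z::'a::euclidean_space))\<^sup>2)) \<partial>lborel) < \<infinity>"
  using nn_integral_exp_norm_square[of "1 / (2 * c)", where 'a='a] assms by (simp add: mult.commute)

lemma nn_integral_pow4_exp_norm_finite:
  fixes c :: real
  assumes c: "c > 0"
  shows "(\<integral>\<^sup>+z. ennreal (norm (z::'a::euclidean_space) ^ 4 * exp (- c * (norm z)\<^sup>2)) \<partial>lborel) < \<infinity>"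
proof -
  have "(\<integral>\<^sup>+z. ennreal (norm (z::'a) ^ 4 * exp (- c * (norm z)\<^sup>2)) \<partial>lborel)
    \<le> (\<integral>\<^sup>+z. ennreal (8 / c\<^sup>2) * ennreal (exp (- (c / 2) * (norm (z::'a))\<^sup>2)) \<partial>lborel)"
    by (intro nn_integral_mono) (use pow4_exp_le[OF c] in \<open>simp flip: ennreal_mult\<close>)
  also have "\<dots> = ennreal (8 / c\<^sup>2) * (\<integral>\<^sup>+z. ennreal (exp (- (c / 2) * (norm (z::'a))\<^sup>2)) \<partial>lborel)"
    by (rule nn_integral_cmult) measurable
  also have "\<dots> < \<infinity>"
    using nn_integral_exp_norm_finite[of "c / 2", where 'a='a] c by (simp add: ennreal_mult_less_top)
  finally show ?thesis .
qed

abbreviation std_gaussian :: "'a::euclidean_space measure" where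
  "std_gaussian \<equiv> gaussian 0 1"

interpretation std_gaussian: prob_space "std_gaussian :: 'a::euclidean_space measure"
  by (rule prob_space_gaussian) simp

text \<open>One domination criterion serves the later expectations: the estimate for a Metropolis
  step involves terms of degree at most four in \<open>z\<close>.\<close>

lemma integrable_std_gaussian:
  fixes f :: "'a::euclidean_space \<Rightarrow> real"
  assumes [measurable]: "f \<in> borel_measurable borel"
    and bound: "\<And>z. \<bar>f z\<bar> \<le> C * (1 + norm z ^ 4)"
  shows "integrable std_gaussian f"
proof -
  have "(\<integral>\<^sup>+z. ennreal (norm (z::'a) ^ 4) \<partial>std_gaussian)
      = (\<integral>\<^sup>+z. ennreal ((2 * pi) powr (- (real DIM('a) / 2))) *
          ennreal (norm (z::'a) ^ 4 * exp (- (1/2) * (norm z)\<^sup>2)) \<partial>lborel)"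
    by (subst nn_integral_gaussian) (auto intro!: nn_integral_cong simp: gaussian_density_def mult_ac simp flip: ennreal_mult)
  also have "\<dots> = ennreal ((2 * pi) powr (- (real DIM('a) / 2))) *
      (\<integral>\<^sup>+z. ennreal (norm (z::'a) ^ 4 * exp (- (1/2) * (norm z)\<^sup>2)) \<partial>lborel)"
    by (rule nn_integral_cmult) measurable
  also have "\<dots> < \<infinity>"
    using nn_integral_pow4_exp_norm_finite[of "1/2", where 'a='a] by (simp add: ennreal_mult_less_top)
  finally have "integrable std_gaussian (\<lambda>z::'a. norm z ^ 4)"
    by (intro integrableI_bounded) auto
  then have "integrable std_gaussian (\<lambda>z::'a. C * (1 + norm z ^ 4))"
    by simp
  then show ?thesis
    by (rule Bochner_Integration.integrable_bound) (auto intro!: always_eventually order_trans[OF bound])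
qed

lemma power_le_pow4:
  fixes r :: real
  assumes "r \<ge> 0" "k \<le> 4"
  shows "r ^ k \<le> 1 + r ^ 4"
proof (cases "r \<le> 1")
  case True
  then have "r ^ k \<le> 1" using assms by (simp add: power_le_one)
  then show ?thesis using assms by (simp add: add_increasing2)
next
  case False
  then have "r ^ k \<le> r ^ 4" using assms by (intro power_increasing) auto
  then show ?thesis by simp
qed

lemma integrable_std_gaussian_norm_power:
  assumes "k \<le> 4"
  shows "integrable std_gaussian (\<lambda>z::'a::euclidean_space. norm z ^ k)"
  by (rule integrable_std_gaussian[where C=1]) (use power_le_pow4[OF norm_ge_zero assms] in auto)

lemma integrable_std_gaussian_inner:
  "integrable std_gaussian (\<lambda>z::'a::euclidean_space. a \<bullet> z)"
proof (rule integrable_std_gaussian[where C="norm a"])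
  show "\<bar>a \<bullet> z\<bar> \<le> norm a * (1 + norm z ^ 4)" for z :: 'a
    using Cauchy_Schwarz_ineq2[of a z] mult_left_mono[OF power_le_pow4[of "norm z" 1], of "norm a"] by simp
qed simp

lemma integrable_std_gaussian_inner2:
  "integrable std_gaussian (\<lambda>z::'a::euclidean_space. (a \<bullet> z) * (b \<bullet> z))"
proof (rule integrable_std_gaussian[where C="norm a * norm b"])
  fix z :: 'a
  have "\<bar>(a \<bullet> z) * (b \<bullet> z)\<bar> \<le> (norm a * norm z) * (norm b * norm z)"
    unfolding abs_mult by (intro mult_mono Cauchy_Schwarz_ineq2) auto
  also have "\<dots> = norm a * norm b * norm z ^ 2"
    by (simp add: power2_eq_square)
  also have "\<dots> \<le> norm a * norm b * (1 + norm z ^ 4)"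
    by (intro mult_left_mono power_le_pow4) auto
  finally show "\<bar>(a \<bullet> z) * (b \<bullet> z)\<bar> \<le> norm a * norm b * (1 + norm z ^ 4)" .
qed simp

section \<open>Reflection symmetry and covariance of the standard Gaussian\<close>

lemma distr_lborel_sign_flip:
  fixes c :: "'a::euclidean_space \<Rightarrow> real"
  assumes c: "\<And>j. j \<in> Basis \<Longrightarrow> \<bar>c j\<bar> = 1"
  shows "distr lborel borel (\<lambda>z. \<Sum>j\<in>Basis. (c j * (z \<bullet> j)) *\<^sub>R j) = lborel"
proof -
  have "c j \<noteq> 0" if "j \<in> Basis" for j
    using c[OF that] by auto
  then have "lborel = density (distr lborel borel (\<lambda>x. 0 + (\<Sum>j\<in>Basis. (c j * (x \<bullet> j)) *\<^sub>R j)))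
      (\<lambda>_. (\<Prod>j\<in>Basis. \<bar>c j\<bar>))"
    by (rule lborel_affine_euclidean)
  then show ?thesis
    by (simp add: c density_1)
qed

text \<open>Coordinate reflections preserve both Lebesgue measure and the norm, hence the Gaussian.
  Reflecting all coordinates kills the first moments, reflecting a single one kills the mixed second
  moments.\<close>

lemma distr_std_gaussian_sign_flip:
  fixes c :: "'a::euclidean_space \<Rightarrow> real"
  assumes c: "\<And>j. j \<in> Basis \<Longrightarrow> \<bar>c j\<bar> = 1"
  shows "distr std_gaussian borel (\<lambda>z. \<Sum>j\<in>Basis. (c j * (z \<bullet> j)) *\<^sub>R j) = std_gaussian"
    (is "distr _ _ ?T = _")
proof (rule measure_eqI)
  have T [measurable]: "?T \<in> borel_measurable borel" by measurable
  have "(norm (?T z))\<^sup>2 = (norm z)\<^sup>2" for z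
  proof -
    have "(norm (?T z))\<^sup>2 = (\<Sum>j\<in>Basis. (?T z \<bullet> j)\<^sup>2)"
      unfolding power2_norm_eq_inner by (subst euclidean_inner) (simp only: power2_eq_square)
    also have "\<dots> = (\<Sum>j\<in>Basis. (z \<bullet> j)\<^sup>2)"
    proof (rule sum.cong)
      fix j :: 'a assume j: "j \<in> Basis"
      then have "(c j)\<^sup>2 = 1" using c[of j] by (simp add: abs_square_eq_1)
      with j show "(?T z \<bullet> j)\<^sup>2 = (z \<bullet> j)\<^sup>2" by (simp add: power_mult_distrib)
    qed simp
    also have "\<dots> = (norm z)\<^sup>2"
      unfolding power2_norm_eq_inner by (subst (2) euclidean_inner) (simp only: power2_eq_square)
    finally show ?thesis .
  qed
  then have dens: "gaussian_density 1 (?T z) = gaussian_density 1 z" for z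
    by (simp add: gaussian_density_def)
  fix A assume "A \<in> sets (distr std_gaussian borel ?T)"
  then have [measurable]: "A \<in> sets borel" by simp
  have "emeasure (distr std_gaussian borel ?T) A = (\<integral>\<^sup>+z. indicator A z \<partial>distr std_gaussian borel ?T)"
    by (rule nn_integral_indicator[symmetric]) simp
  also have "\<dots> = (\<integral>\<^sup>+z. indicator A (?T z) \<partial>std_gaussian)"
    by (rule nn_integral_distr) measurable
  also have "\<dots> = (\<integral>\<^sup>+z. ennreal (gaussian_density 1 (?T z)) * indicator A (?T z) \<partial>lborel)"
    by (simp add: nn_integral_gaussian dens del: inner_sum_left)
  also have "\<dots> = (\<integral>\<^sup>+z. ennreal (gaussian_density 1 z) * indicator A z \<partial>distr lborel borel ?T)"
    by (subst nn_integral_distr) auto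
  also have "\<dots> = (\<integral>\<^sup>+z. indicator A z \<partial>std_gaussian)"
    by (simp only: distr_lborel_sign_flip[OF c]) (subst nn_integral_gaussian, auto)
  finally show "emeasure (distr std_gaussian borel ?T) A = emeasure std_gaussian A" by simp
qed simp

lemma integral_std_gaussian_sign_flip:
  fixes c :: "'a::euclidean_space \<Rightarrow> real" and f :: "'a \<Rightarrow> real"
  assumes c: "\<And>j. j \<in> Basis \<Longrightarrow> \<bar>c j\<bar> = 1" and [measurable]: "f \<in> borel_measurable borel"
  shows "(\<integral>z. f (\<Sum>j\<in>Basis. (c j * (z \<bullet> j)) *\<^sub>R j) \<partial>std_gaussian) = (\<integral>z. f z \<partial>std_gaussian)"
  by (subst (2) distr_std_gaussian_sign_flip[OF c, symmetric]) (auto simp: integral_distr)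

lemma integral_std_gaussian_uminus:
  fixes f :: "'a::euclidean_space \<Rightarrow> real"
  assumes "f \<in> borel_measurable borel"
  shows "(\<integral>z. f (- z) \<partial>std_gaussian) = (\<integral>z. f z \<partial>std_gaussian)"
proof -
  have "(\<Sum>j\<in>Basis. (- 1 * (z \<bullet> j)) *\<^sub>R j) = - z" for z :: 'a
    by (simp add: sum_negf euclidean_representation)
  then show ?thesis
    using integral_std_gaussian_sign_flip[of "\<lambda>_. - 1" f] assms by simp
qed

lemma integral_std_gaussian_inner: "(\<integral>z. (a::'a::euclidean_space) \<bullet> z \<partial>std_gaussian) = 0"
  using integral_std_gaussian_uminus[of "\<lambda>z. a \<bullet> z"] by simp

lemma std_gaussian_density_eq_prod:
  fixes z :: "'a::euclidean_space"
  shows "gaussian_density 1 z = (\<Prod>b\<in>Basis. std_normal_density (z \<bullet> b))"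
proof -
  have "(2 * pi) powr (- (real DIM('a) / 2)) = ((2 * pi) powr (- (1/2))) ^ DIM('a)"
    by (simp add: powr_power)
  also have "(2 * pi) powr (- (1/2)) = 1 / sqrt (2 * pi)"
    by (subst powr_minus) (simp add: powr_half_sqrt inverse_eq_divide)
  finally have "gaussian_density 1 z = (1 / sqrt (2 * pi)) ^ DIM('a) * (\<Prod>b\<in>Basis. exp (- (z \<bullet> b)\<^sup>2 / (2 * 1)))"
    unfolding gaussian_density_def exp_norm_eq_prod by (simp only: mult_1_right)
  then show ?thesis
    by (simp only: std_normal_density_def prod.distrib prod_constant mult_1_right)
qed

text \<open>The density is a product of one-dimensional normal densities: only the factor at
  \<open>i\<close> carries the square, and every factor integrates to 1.\<close>

lemma integral_std_gaussian_coordinate_square: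
  fixes i :: "'a::euclidean_space"
  assumes i: "i \<in> Basis"
  shows "(\<integral>z. (z \<bullet> i)\<^sup>2 \<partial>std_gaussian) = 1"
proof -
  define g where "g b x = std_normal_density x * (if b = i then x\<^sup>2 else 1)" for b x
  have g: "(\<integral>\<^sup>+x. ennreal (g b x) \<partial>lborel) = 1" for b
  proof (cases "b = i")
    case True
    have "has_bochner_integral lborel (\<lambda>x. std_normal_density x * x\<^sup>2) 1"
      using std_normal_moment_even[of 1] by (simp add: fact_2)
    then show ?thesis
      using True nn_integral_eq_integral[of lborel "\<lambda>x. std_normal_density x * x\<^sup>2"]
      by (simp add: g_def has_bochner_integral_iff)
  next
    case False
    then show ?thesis
      using nn_integral_eq_integral[of lborel std_normal_density] by (simp add: g_def)
  qed
  have prod_g: "gaussian_density 1 z * (z \<bullet> i)\<^sup>2 = (\<Prod>b\<in>Basis. g b (z \<bullet> b))" for z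
    unfolding g_def prod.distrib std_gaussian_density_eq_prod
    using i prod.delta[of Basis i "\<lambda>b. (z \<bullet> b)\<^sup>2"] by (simp add: eq_commute)
  have "(\<integral>\<^sup>+z. ennreal ((z \<bullet> i)\<^sup>2) \<partial>std_gaussian)
      = (\<integral>\<^sup>+z. (\<Prod>b\<in>Basis. ennreal (g b (z \<bullet> b))) \<partial>lborel)"
  proof -
    have "ennreal (gaussian_density 1 z) * ennreal ((z \<bullet> i)\<^sup>2) = (\<Prod>b\<in>Basis. ennreal (g b (z \<bullet> b)))" for z
      by (subst prod_ennreal) (auto simp: g_def simp flip: ennreal_mult prod_g[unfolded g_def])
    then show ?thesis by (simp add: nn_integral_gaussian)
  qed
  also have "\<dots> = (\<Prod>b\<in>(Basis::'a set). \<integral>\<^sup>+x. ennreal (g b x) \<partial>lborel)"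
    by (rule nn_integral_lborel_prod) (auto simp: g_def[abs_def])
  also have "\<dots> = 1" by (simp add: g)
  finally show ?thesis
    by (subst integral_eq_nn_integral) auto
qed

lemma integral_std_gaussian_coordinates:
  fixes i j :: "'a::euclidean_space"
  assumes i: "i \<in> Basis" and j: "j \<in> Basis"
  shows "(\<integral>z. (z \<bullet> i) * (z \<bullet> j) \<partial>std_gaussian) = (if i = j then 1 else 0)"
proof (cases "i = j")
  case True
  then show ?thesis using integral_std_gaussian_coordinate_square[OF i] by (simp add: power2_eq_square)
next
  case False
  \<comment> \<open>Reflecting coordinate \<open>i\<close> alone reverses the sign of the product,
    so the integral equals its own negative.\<close>
  define c where "c b = (if b = i then - 1 else 1 :: real)" for b
  have "(\<integral>z. ((\<Sum>b\<in>Basis. (c b * (z \<bullet> b)) *\<^sub>R b) \<bullet> i) * ((\<Sum>b\<in>Basis. (c b * (z \<bullet> b)) *\<^sub>R b) \<bullet> j) \<partial>std_gaussian)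
    = (\<integral>z. (z \<bullet> i) * (z \<bullet> j) \<partial>std_gaussian)"
    by (rule integral_std_gaussian_sign_flip) (auto simp: c_def)
  moreover have "((\<Sum>b\<in>Basis. (c b * (z \<bullet> b)) *\<^sub>R b) \<bullet> i) = - (z \<bullet> i)"
    "((\<Sum>b\<in>Basis. (c b * (z \<bullet> b)) *\<^sub>R b) \<bullet> j) = z \<bullet> j" for z
    using i j False by (simp_all add: c_def)
  ultimately show ?thesis using False by simp
qed

lemma integral_std_gaussian_inner2:
  fixes a b :: "'a::euclidean_space"
  shows "(\<integral>z. (a \<bullet> z) * (b \<bullet> z) \<partial>std_gaussian) = a \<bullet> b"
proof -
  have int: "integrable std_gaussian (\<lambda>z. (z \<bullet> i) * (z \<bullet> j))" for i j :: 'a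
    using integrable_std_gaussian_inner2[of i j] by (simp add: inner_commute)
  have "(a \<bullet> z) * (b \<bullet> z) = (\<Sum>i\<in>Basis. \<Sum>j\<in>Basis. (a \<bullet> i) * (b \<bullet> j) * ((z \<bullet> i) * (z \<bullet> j)))" for z
    by (subst (1 2) euclidean_inner) (simp add: sum_product mult_ac)
  then have "(\<integral>z. (a \<bullet> z) * (b \<bullet> z) \<partial>std_gaussian)
    = (\<Sum>i\<in>Basis. \<Sum>j\<in>Basis. (a \<bullet> i) * (b \<bullet> j) * (\<integral>z. (z \<bullet> i) * (z \<bullet> j) \<partial>std_gaussian))"
    using int by simp
  also have "\<dots> = (\<Sum>i\<in>Basis. \<Sum>j\<in>Basis. if i = j then (a \<bullet> i) * (b \<bullet> j) else 0)"
    by (intro sum.cong) (auto simp: integral_std_gaussian_coordinates)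
  also have "\<dots> = a \<bullet> b"
    by (simp add: euclidean_inner[of a b])
  finally show ?thesis .
qed

lemma integral_std_gaussian_norm_square:
  "(\<integral>z. (norm z)\<^sup>2 \<partial>(std_gaussian :: 'a::euclidean_space measure)) = real DIM('a)"
proof -
  have "(norm z)\<^sup>2 = (\<Sum>b\<in>Basis. (b \<bullet> z) * (b \<bullet> z))" for z :: 'a
    unfolding power2_norm_eq_inner by (subst euclidean_inner) (simp add: inner_commute)
  then show ?thesis
    by (simp add: integrable_std_gaussian_inner2 integral_std_gaussian_inner2 inner_same_Basis)
qed

section \<open>Strongly convex potentials and their Gibbs measures\<close>

text \<open>These are the hypotheses on the potential. The sequence of step sizes stays outside,
  because the analysis in this locale treats one Langevin step at a time.\<close>

locale strongly_convex_potential =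
  fixes U :: "'a::euclidean_space \<Rightarrow> real" and gradU :: "'a \<Rightarrow> 'a" and L m :: real
  assumes gradient: "\<And>y. GDERIV U y :> gradU y"
    and gradient_continuous: "continuous_on UNIV gradU"
    and L_nonneg: "L \<ge> 0" and m_pos: "m > 0"
    and lipschitz: "\<And>y z. norm (gradU y - gradU z) \<le> L * norm (y - z)"
    and strongly_convex:
      "\<And>y z. U z \<ge> U y + inner (gradU y) (z - y) + m / 2 * (norm (y - z))\<^sup>2"
begin

section \<open>Smoothness, convexity and the minimizer\<close>

lemma U_measurable [measurable]: "U \<in> borel_measurable borel"
proof -
  have "isCont U y" for y
    using gradient[of y] unfolding gderiv_def by (rule has_derivative_continuous)
  then show ?thesis
    by (intro borel_measurable_continuous_onI continuous_at_imp_continuous_on) auto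
qed

lemma gradU_measurable [measurable]: "gradU \<in> borel_measurable borel"
  by (rule borel_measurable_continuous_onI[OF gradient_continuous])

text \<open>The descent lemma. Along the segment from \<open>y\<close> to \<open>z\<close>, the
  potential minus its quadratic upper model has nonpositive derivative, since the gradient moves by
  at most \<open>L * t * norm v\<close>.\<close>

lemma U_le_quadratic: "U z \<le> U y + gradU y \<bullet> (z - y) + L / 2 * (norm (z - y))\<^sup>2"
proof -
  define v where "v = z - y"
  define \<phi> where "\<phi> t = U (y + t *\<^sub>R v) - t * (gradU y \<bullet> v) - L / 2 * t\<^sup>2 * (norm v)\<^sup>2" for t
  have "\<phi> 1 \<le> \<phi> 0"
  proof (rule DERIV_nonpos_imp_nonincreasing[of 0 1 \<phi>])
    fix t :: real assume t: "0 \<le> t" "t \<le> 1"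
    have "((\<lambda>t. U (y + t *\<^sub>R v)) has_derivative (\<lambda>h. (h *\<^sub>R v) \<bullet> gradU (y + t *\<^sub>R v))) (at t)"
    proof (rule has_derivative_compose[of "\<lambda>t. y + t *\<^sub>R v" "\<lambda>h. h *\<^sub>R v" t UNIV U "\<lambda>h. h \<bullet> gradU (y + t *\<^sub>R v)"])
      show "((\<lambda>t. y + t *\<^sub>R v) has_derivative (\<lambda>h. h *\<^sub>R v)) (at t)"
        by (auto intro!: derivative_eq_intros)
    qed (use gradient in \<open>simp add: gderiv_def\<close>)
    then have "((\<lambda>t. U (y + t *\<^sub>R v)) has_real_derivative (v \<bullet> gradU (y + t *\<^sub>R v))) (at t)"
      by (simp add: has_field_derivative_def mult_commute_abs)
    then have "(\<phi> has_real_derivative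
        (v \<bullet> gradU (y + t *\<^sub>R v) - gradU y \<bullet> v - L * t * (norm v)\<^sup>2)) (at t)"
      unfolding \<phi>_def by (auto intro!: derivative_eq_intros)
    moreover have "v \<bullet> gradU (y + t *\<^sub>R v) - gradU y \<bullet> v - L * t * (norm v)\<^sup>2 \<le> 0"
    proof -
      have "v \<bullet> gradU (y + t *\<^sub>R v) - gradU y \<bullet> v = v \<bullet> (gradU (y + t *\<^sub>R v) - gradU y)"
        by (simp add: inner_diff_right inner_commute)
      also have "\<dots> \<le> norm v * norm (gradU (y + t *\<^sub>R v) - gradU y)"
        by (rule norm_cauchy_schwarz)
      also have "\<dots> \<le> norm v * (L * norm (t *\<^sub>R v))"
        using lipschitz[of "y + t *\<^sub>R v" y] by (intro mult_left_mono) auto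
      also have "\<dots> = L * t * (norm v)\<^sup>2"
        using t by (simp add: power2_eq_square)
      finally show ?thesis by simp
    qed
    ultimately show "\<exists>d. DERIV \<phi> t :> d \<and> d \<le> 0" by blast
  qed simp
  then show ?thesis by (simp add: \<phi>_def v_def)
qed

text \<open>Outside the ball of radius \<open>R\<close> the quadratic term of strong convexity at 0
  outweighs the linear one, so \<open>U\<close> is at least \<open>U 0\<close> there. A minimum over
  the compact ball is therefore global.\<close>

lemma ex_minimum: "\<exists>z. \<forall>y. U z \<le> U y"
proof -
  define R where "R = 2 * norm (gradU 0) / m"
  have R: "R \<ge> 0" using m_pos by (simp add: R_def)
  have "continuous_on (cball 0 R) U"
    using gradient has_derivative_continuous unfolding gderiv_def
    by (intro continuous_at_imp_continuous_on) blast
  then obtain z where z: "z \<in> cball 0 R" "\<And>y. y \<in> cball 0 R \<Longrightarrow> U z \<le> U y"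
    using continuous_attains_inf[of "cball (0::'a) R" U] R by auto
  have "U z \<le> U y" for y
  proof (cases "y \<in> cball 0 R")
    case False
    then have "norm y > R" by simp
    then have "m / 2 * norm y \<ge> norm (gradU 0)"
      using m_pos by (simp add: R_def field_simps)
    then have "norm (gradU 0) * norm y \<le> m / 2 * (norm y)\<^sup>2"
      unfolding power2_eq_square mult.assoc[symmetric] by (rule mult_right_mono) simp
    moreover have "- (gradU 0 \<bullet> y) \<le> norm (gradU 0) * norm y"
      using Cauchy_Schwarz_ineq2[of "gradU 0" y] by linarith
    ultimately have "U 0 \<le> U y"
      using strongly_convex[of 0 y] by simp
    then show ?thesis using z(2)[of 0] R by simp
  qed (rule z(2))
  then show ?thesis by blast
qed

lemma gradU_minimum:
  assumes "\<And>y. U z \<le> U y"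
  shows "gradU z = 0"
proof (rule ccontr)
  assume nz: "gradU z \<noteq> 0"
  \<comment> \<open>A gradient step of this length would strictly lower \<open>U\<close> by the
    descent lemma. The summand 1 keeps the length positive and well defined when \<open>L\<close> is
    0.\<close>
  define e where "e = 1 / (L + 1)"
  have e: "e > 0" "L * e \<le> 1" using L_nonneg by (simp_all add: e_def field_simps)
  have "U z \<le> U z + gradU z \<bullet> (- e *\<^sub>R gradU z) + L / 2 * (norm (- e *\<^sub>R gradU z))\<^sup>2"
    using assms[of "z - e *\<^sub>R gradU z"] U_le_quadratic[of "z - e *\<^sub>R gradU z" z] by simp
  then have "e * (norm (gradU z))\<^sup>2 \<le> L / 2 * (e\<^sup>2 * (norm (gradU z))\<^sup>2)"
    using e by (simp add: power_mult_distrib power2_norm_eq_inner)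
  also have "\<dots> = e * (norm (gradU z))\<^sup>2 * (L * e) / 2"
    by (simp add: power2_eq_square)
  also have "\<dots> \<le> e * (norm (gradU z))\<^sup>2 * 1 / 2"
    using e by (intro divide_right_mono mult_left_mono) auto
  also have "\<dots> < e * (norm (gradU z))\<^sup>2"
    using e nz by simp
  finally show False by simp
qed

lemma minimum_unique:
  assumes "\<And>y. U z \<le> U y" and "\<And>y. U z' \<le> U y"
  shows "z' = z"
proof -
  have "m / 2 * (norm (z - z'))\<^sup>2 \<le> 0"
    using strongly_convex[of z z'] gradU_minimum[of z] assms(1) assms(2)[of z] by simp
  then show ?thesis using m_pos by (simp add: mult_le_0_iff)
qed

text \<open>Existence and uniqueness both enter here, as \<open>minimizer\<close> is a definite
  description.\<close>

lemma minimizer_le: "U (minimizer U) \<le> U y"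
proof -
  obtain z where z: "\<And>y. U z \<le> U y" using ex_minimum by blast
  have "minimizer U = z"
    unfolding minimizer_def is_arg_min_def
  proof (rule the_equality)
    show "True \<and> \<not> (\<exists>y. True \<and> U y < U z)"
      using z by (auto simp: not_less)
    show "z' = z" if "True \<and> \<not> (\<exists>y. True \<and> U y < U z')" for z'
      using that minimum_unique[of z z'] z by (auto simp: not_less)
  qed
  then show ?thesis using z by simp
qed

lemma gradU_minimizer: "gradU (minimizer U) = 0"
  by (rule gradU_minimum[OF minimizer_le])

text \<open>The potential is shifted to be nonnegative, so that its integrals make sense in \<open>ennreal\<close>.\<close>

definition V :: "'a \<Rightarrow> real" where
  "V y = U y - U (minimizer U)"

lemma V_measurable [measurable]: "V \<in> borel_measurable borel"
  unfolding V_def[abs_def] by measurable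

lemma V_nonneg: "0 \<le> V y"
  using minimizer_le by (simp add: V_def)

lemma V_lower: "m / 2 * (norm (y - minimizer U))\<^sup>2 \<le> V y"
  using strongly_convex[of "minimizer U" y] gradU_minimizer by (simp add: V_def norm_minus_commute)

lemma V_upper: "V y \<le> L / 2 * (norm (y - minimizer U))\<^sup>2"
  using U_le_quadratic[of y "minimizer U"] gradU_minimizer by (simp add: V_def)

lemma norm_gradU_le: "norm (gradU y) \<le> L * norm (y - minimizer U)"
  using lipschitz[of y "minimizer U"] gradU_minimizer by simp

text \<open>Adding the strong convexity inequalities for the two orders of the points cancels the
  values of \<open>U\<close>; the gradient at the minimizer is zero.\<close>

lemma gradU_inner_ge: "m * (norm w)\<^sup>2 \<le> gradU (minimizer U + w) \<bullet> w"
  using strongly_convex[of "minimizer U + w" "minimizer U"] strongly_convex[of "minimizer U" "minimizer U + w"]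
    gradU_minimizer by (simp add: inner_commute)

text \<open>Expanding the square leaves an inner product that strong convexity turns into
  \<open>V y - V x\<close>; the descent lemma then trades \<open>V x\<close> for \<open>V\<close> at
  the new point. What remains of \<open>(norm g)\<^sup>2\<close> has the coefficient
  \<open>- (1 - L * h) * h\<^sup>2\<close>. The term with \<open>V\<close> of the new point is kept
  on the left to pay for the Gaussian phase that follows.\<close>

lemma gradient_step:
  assumes h: "0 < h" "L * h \<le> 1"
  shows "(norm (x - h *\<^sub>R gradU x - y))\<^sup>2 + 2 * h * V (x - h *\<^sub>R gradU x)
    \<le> (1 - m * h) * (norm (x - y))\<^sup>2 + 2 * h * V y"
proof -
  define g where "g = gradU x"
  have "(norm (x - h *\<^sub>R g - y))\<^sup>2 = (norm (x - y))\<^sup>2 + 2 * h * (g \<bullet> (y - x)) + h\<^sup>2 * (norm g)\<^sup>2"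
    unfolding power2_norm_eq_inner
    by (simp add: inner_diff_left inner_diff_right inner_commute algebra_simps power2_eq_square)
  moreover have "2 * h * (g \<bullet> (y - x)) \<le> 2 * h * (V y - V x - m / 2 * (norm (x - y))\<^sup>2)"
    using strongly_convex[of x y] h(1) by (intro mult_left_mono) (auto simp: g_def V_def)
  moreover have "2 * h * V (x - h *\<^sub>R g) \<le> 2 * h * (V x - h * (norm g)\<^sup>2 + L / 2 * (h\<^sup>2 * (norm g)\<^sup>2))"
  proof (rule mult_left_mono)
    have "U (x - h *\<^sub>R g) \<le> U x - h * (g \<bullet> g) + L / 2 * (norm (h *\<^sub>R g))\<^sup>2"
      using U_le_quadratic[of "x - h *\<^sub>R g" x] by (simp add: g_def)
    also have "(norm (h *\<^sub>R g))\<^sup>2 = h\<^sup>2 * (norm g)\<^sup>2"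
      by (simp add: power_mult_distrib)
    finally show "V (x - h *\<^sub>R g) \<le> V x - h * (norm g)\<^sup>2 + L / 2 * (h\<^sup>2 * (norm g)\<^sup>2)"
      unfolding V_def power2_norm_eq_inner by simp
  qed (use h in simp)
  moreover have "(L * h) * (h\<^sup>2 * (norm g)\<^sup>2) \<le> 1 * (h\<^sup>2 * (norm g)\<^sup>2)"
    using h by (intro mult_right_mono) auto
  ultimately show ?thesis
    unfolding g_def[symmetric] by (simp add: algebra_simps power2_eq_square)
qed

section \<open>Normalising constant and moments of the Gibbs measure\<close>

definition Z :: real where
  "Z = (\<integral>y. exp (- U y) \<partial>lborel)"

text \<open>Strong convexity dominates the Gibbs weight by a Gaussian centred at the minimizer;
  normalisability and finite moments follow from this.\<close>

lemma exp_U_le: "exp (- U (minimizer U + v)) \<le> exp (- U (minimizer U)) * exp (- (m / 2) * (norm v)\<^sup>2)"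
  using V_lower[of "minimizer U + v"] by (simp add: V_def flip: exp_add)

lemma nn_integral_exp_U_pow4_finite:
  "(\<integral>\<^sup>+v. ennreal (exp (- U (minimizer U + v)) * norm v ^ 4) \<partial>lborel) < \<infinity>"
proof -
  have "(\<integral>\<^sup>+v. ennreal (exp (- U (minimizer U + v)) * norm v ^ 4) \<partial>lborel)
    \<le> (\<integral>\<^sup>+v. ennreal (exp (- U (minimizer U))) * ennreal (norm (v::'a) ^ 4 * exp (- (m / 2) * (norm v)\<^sup>2)) \<partial>lborel)"
  proof (intro nn_integral_mono)
    fix v :: 'a
    have "exp (- U (minimizer U + v)) * norm v ^ 4
      \<le> exp (- U (minimizer U)) * exp (- (m / 2) * (norm v)\<^sup>2) * norm v ^ 4"
      by (intro mult_right_mono exp_U_le) simp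
    then show "ennreal (exp (- U (minimizer U + v)) * norm v ^ 4)
      \<le> ennreal (exp (- U (minimizer U))) * ennreal (norm v ^ 4 * exp (- (m / 2) * (norm v)\<^sup>2))"
      by (simp add: mult_ac flip: ennreal_mult)
  qed
  also have "\<dots> = ennreal (exp (- U (minimizer U))) *
      (\<integral>\<^sup>+v. ennreal (norm (v::'a) ^ 4 * exp (- (m / 2) * (norm v)\<^sup>2)) \<partial>lborel)"
    by (rule nn_integral_cmult) measurable
  also have "\<dots> < \<infinity>"
    using nn_integral_pow4_exp_norm_finite[of "m / 2", where 'a='a] m_pos by (simp add: ennreal_mult_less_top)
  finally show ?thesis .
qed

lemma nn_integral_exp_U_finite: "(\<integral>\<^sup>+v. ennreal (exp (- U (minimizer U + v))) \<partial>lborel) < \<infinity>"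
proof -
  have "(\<integral>\<^sup>+v. ennreal (exp (- U (minimizer U + v))) \<partial>lborel)
    \<le> (\<integral>\<^sup>+v. ennreal (exp (- U (minimizer U))) * ennreal (exp (- (m / 2) * (norm (v::'a))\<^sup>2)) \<partial>lborel)"
    using exp_U_le by (intro nn_integral_mono) (simp flip: ennreal_mult)
  also have "\<dots> = ennreal (exp (- U (minimizer U))) *
      (\<integral>\<^sup>+v. ennreal (exp (- (m / 2) * (norm (v::'a))\<^sup>2)) \<partial>lborel)"
    by (rule nn_integral_cmult) measurable
  also have "\<dots> < \<infinity>"
    using nn_integral_exp_norm_finite[of "m / 2", where 'a='a] m_pos by (simp add: ennreal_mult_less_top)
  finally show ?thesis .
qed

lemma nn_integral_exp_U: "(\<integral>\<^sup>+y. ennreal (exp (- U y)) \<partial>lborel) = ennreal Z"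
proof -
  have "(\<integral>\<^sup>+y. ennreal (exp (- U y)) \<partial>lborel) < \<infinity>"
    using nn_integral_exp_U_finite nn_integral_lborel_shift[of "\<lambda>y. ennreal (exp (- U y))" "minimizer U"]
    by (simp add: add.commute)
  then have "integrable lborel (\<lambda>y. exp (- U y))"
    by (intro integrableI_bounded) auto
  then show ?thesis
    unfolding Z_def by (intro nn_integral_eq_integral) auto
qed

text \<open>\<open>gibbs\<close> divides by this constant, and division by zero would turn it into
  the zero measure.\<close>

lemma Z_pos: "Z > 0"
proof (rule ccontr)
  assume "\<not> Z > 0"
  then have "(\<integral>\<^sup>+y. ennreal (exp (- U y)) \<partial>lborel) = 0"
    by (simp add: nn_integral_exp_U ennreal_neg)
  then have "AE y in (lborel :: 'a measure). ennreal (exp (- U y)) = 0"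
    by (subst (asm) nn_integral_0_iff_AE) auto
  then have "AE y in (lborel :: 'a measure). False" by simp
  then show False
    by (simp add: AE_iff_null null_sets_def)
qed

lemma nn_integral_gibbs:
  assumes [measurable]: "f \<in> borel_measurable borel"
  shows "(\<integral>\<^sup>+y. f y \<partial>gibbs U) = ennreal (1 / Z) * (\<integral>\<^sup>+y. ennreal (exp (- U y)) * f y \<partial>lborel)"
proof -
  have "(\<integral>\<^sup>+y. f y \<partial>gibbs U) = (\<integral>\<^sup>+y. ennreal (exp (- U y) / Z) * f y \<partial>lborel)"
    unfolding gibbs_def Z_def[symmetric] by (subst nn_integral_density) auto
  also have "\<dots> = (\<integral>\<^sup>+y. ennreal (1 / Z) * (ennreal (exp (- U y)) * f y) \<partial>lborel)"
    using Z_pos by (intro nn_integral_cong) (simp add: mult.assoc[symmetric] flip: ennreal_mult)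
  also have "\<dots> = ennreal (1 / Z) * (\<integral>\<^sup>+y. ennreal (exp (- U y)) * f y \<partial>lborel)"
    by (rule nn_integral_cmult) measurable
  finally show ?thesis .
qed

lemma sets_gibbs [simp, measurable_cong]: "sets (gibbs U) = sets borel"
  by (simp add: gibbs_def)

lemma space_gibbs [simp]: "space (gibbs U) = UNIV"
  by (simp add: gibbs_def)

lemma prob_space_gibbs: "prob_space (gibbs U)"
proof (rule prob_spaceI)
  have "emeasure (gibbs U) (space (gibbs U)) = (\<integral>\<^sup>+y. 1 \<partial>gibbs U)" by simp
  also have "\<dots> = ennreal (1 / Z) * ennreal Z"
    by (subst nn_integral_gibbs) (auto simp: nn_integral_exp_U)
  also have "\<dots> = 1" using Z_pos by (simp flip: ennreal_mult)
  finally show "emeasure (gibbs U) (space (gibbs U)) = 1" .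
qed

lemma gibbs_centered:
  assumes [measurable]: "f \<in> borel_measurable borel"
  shows "(\<integral>\<^sup>+y. f (y - minimizer U) \<partial>gibbs U)
    = ennreal (1 / Z) * (\<integral>\<^sup>+v. ennreal (exp (- U (minimizer U + v))) * f v \<partial>lborel)"
proof -
  have "(\<integral>\<^sup>+y. ennreal (exp (- U y)) * f (y - minimizer U) \<partial>lborel)
    = (\<integral>\<^sup>+v. ennreal (exp (- U (v + minimizer U))) * f (v + minimizer U - minimizer U) \<partial>lborel)"
    by (rule nn_integral_lborel_shift[symmetric]) measurable
  then show ?thesis by (subst nn_integral_gibbs) (auto simp: add.commute)
qed

lemma gibbs_pow4_finite: "(\<integral>\<^sup>+y. ennreal (norm (y - minimizer U) ^ 4) \<partial>gibbs U) < \<infinity>"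
  using nn_integral_exp_U_pow4_finite
  by (subst gibbs_centered) (auto simp: ennreal_mult_less_top simp flip: ennreal_mult)

text \<open>In coordinates centred at the minimizer, rescaling gives
  \<open>\<integral> exp (- U (s v)) = s\<^sup>-\<^sup>d \<integral> exp (- U v)\<close>; strong convexity bounds the left side below in terms
  of the second moment, and \<open>s \<rightarrow> 1\<close> replaces an integration by parts.\<close>

lemma gibbs_second_moment:
  "(\<integral>\<^sup>+y. ennreal ((norm (y - minimizer U))\<^sup>2) \<partial>gibbs U) \<le> ennreal (real DIM('a) / m)"
proof -
  define W where "W v = exp (- U (minimizer U + v))" for v
  define M where "M = (\<integral>\<^sup>+v. ennreal (W v * (norm v)\<^sup>2) \<partial>lborel)"
  have [measurable]: "W \<in> borel_measurable borel" unfolding W_def[abs_def] by measurable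
  have W_pos: "W v > 0" for v by (simp add: W_def)
  have Z: "(\<integral>\<^sup>+v. ennreal (W v) \<partial>lborel) = ennreal Z"
    using nn_integral_lborel_shift[of "\<lambda>y. ennreal (exp (- U y))" "minimizer U"] nn_integral_exp_U
    by (simp add: W_def add.commute)
  \<comment> \<open>Finiteness, obtained from the fourth moment, lets the argument continue in the
    reals, where subtraction is available.\<close>
  have "M \<le> (\<integral>\<^sup>+v. ennreal (W v) + ennreal (W v * norm v ^ 4) \<partial>lborel)"
    unfolding M_def
  proof (intro nn_integral_mono)
    fix v
    have "W v * (norm v)\<^sup>2 \<le> W v * (1 + norm v ^ 4)"
      using W_pos[of v] by (intro mult_left_mono power_le_pow4) auto
    then show "ennreal (W v * (norm v)\<^sup>2) \<le> ennreal (W v) + ennreal (W v * norm v ^ 4)"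
      using W_pos[of v] by (simp add: distrib_left flip: ennreal_plus)
  qed
  also have "\<dots> < \<infinity>"
    using nn_integral_exp_U_pow4_finite Z unfolding W_def[symmetric] by (subst nn_integral_add) auto
  finally obtain M2 where M2: "M = ennreal M2" "M2 \<ge> 0"
    by (cases M) auto
  have bound: "s ^ (DIM('a) + 1) * (m * M2) \<le> real DIM('a) * Z" if s: "0 < s" "s < 1" for s
  proof -
    \<comment> \<open>Convexity at \<open>minimizer U + s *\<^sub>R v\<close> in the direction
      \<open>v\<close>, together with \<open>gradU_inner_ge\<close>, bounds the energy difference
      below by \<open>m * s * (1 - s) * (norm v)\<^sup>2\<close>; then \<open>exp t\<close> is at
      least \<open>1 + t\<close>.\<close>
    have pt: "W v * (1 + m * s * (1 - s) * (norm v)\<^sup>2) \<le> W (s *\<^sub>R v)" for v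
    proof -
      have "m * (norm (s *\<^sub>R v))\<^sup>2 \<le> s * (gradU (minimizer U + s *\<^sub>R v) \<bullet> v)"
        using gradU_inner_ge[of "s *\<^sub>R v"] by simp
      then have "s * (m * s * (norm v)\<^sup>2) \<le> s * (gradU (minimizer U + s *\<^sub>R v) \<bullet> v)"
        by (simp add: power_mult_distrib power2_eq_square mult_ac)
      then have "m * s * (norm v)\<^sup>2 \<le> gradU (minimizer U + s *\<^sub>R v) \<bullet> v"
        using s by simp
      then have "(1 - s) * (m * s * (norm v)\<^sup>2) \<le> (1 - s) * (gradU (minimizer U + s *\<^sub>R v) \<bullet> v)"
        using s by (intro mult_left_mono) auto
      also have "\<dots> = gradU (minimizer U + s *\<^sub>R v) \<bullet> (minimizer U + v - (minimizer U + s *\<^sub>R v))"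
        by (simp add: inner_diff_right algebra_simps)
      also have "\<dots> \<le> U (minimizer U + v) - U (minimizer U + s *\<^sub>R v)"
      proof -
        have "0 \<le> m / 2 * (norm (minimizer U + s *\<^sub>R v - (minimizer U + v)))\<^sup>2"
          using m_pos by simp
        then show ?thesis
          using strongly_convex[of "minimizer U + s *\<^sub>R v" "minimizer U + v"] by linarith
      qed
      finally have "1 + m * s * (1 - s) * (norm v)\<^sup>2
          \<le> exp (U (minimizer U + v) - U (minimizer U + s *\<^sub>R v))"
        by (intro order_trans[OF _ exp_ge_add_one_self]) (simp add: mult_ac)
      then have "W v * (1 + m * s * (1 - s) * (norm v)\<^sup>2)
          \<le> W v * exp (U (minimizer U + v) - U (minimizer U + s *\<^sub>R v))"
        using W_pos[of v] by (intro mult_left_mono) auto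
      then show ?thesis by (simp add: W_def flip: exp_add)
    qed
    have "ennreal (s ^ DIM('a)) * (ennreal Z + ennreal (m * s * (1 - s)) * M)
      = ennreal (s ^ DIM('a)) * (\<integral>\<^sup>+v. ennreal (W v) + ennreal (m * s * (1 - s)) * ennreal (W v * (norm v)\<^sup>2) \<partial>lborel)"
      by (simp add: nn_integral_add nn_integral_cmult Z M_def)
    also have "\<dots> \<le> ennreal (s ^ DIM('a)) * (\<integral>\<^sup>+v. ennreal (W (s *\<^sub>R v)) \<partial>lborel)"
    proof (intro mult_left_mono nn_integral_mono)
      fix v
      have "ennreal (W v) + ennreal (m * s * (1 - s)) * ennreal (W v * (norm v)\<^sup>2)
        = ennreal (W v * (1 + m * s * (1 - s) * (norm v)\<^sup>2))"
        using s m_pos W_pos[of v] by (simp add: distrib_left mult_ac flip: ennreal_mult ennreal_plus)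
      also have "\<dots> \<le> ennreal (W (s *\<^sub>R v))" using pt by (rule ennreal_leI)
      finally show "ennreal (W v) + ennreal (m * s * (1 - s)) * ennreal (W v * (norm v)\<^sup>2) \<le> ennreal (W (s *\<^sub>R v))" .
    qed simp
    also have "\<dots> = ennreal Z"
      using nn_integral_lborel_affine[of "\<lambda>v. ennreal (W v)" s 0] s Z by simp
    finally have "s ^ DIM('a) * (Z + m * s * (1 - s) * M2) \<le> Z"
      using s m_pos Z_pos M2 by (simp add: M2(1) flip: ennreal_mult ennreal_plus)
    then have "(1 - s) * (s ^ (DIM('a) + 1) * (m * M2)) \<le> (1 - s ^ DIM('a)) * Z"
      by (simp add: algebra_simps)
    \<comment> \<open>The factor \<open>1 - s\<close> now stands on both sides and cancels; the
      geometric sum that is left is at most the dimension.\<close>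
    also have "1 - s ^ DIM('a) = (1 - s) * (\<Sum>i<DIM('a). s ^ i)"
      by (rule one_diff_power_eq)
    finally have "(1 - s) * (s ^ (DIM('a) + 1) * (m * M2)) \<le> (1 - s) * ((\<Sum>i<DIM('a). s ^ i) * Z)"
      by (simp only: mult.assoc)
    then have "s ^ (DIM('a) + 1) * (m * M2) \<le> (\<Sum>i<DIM('a). s ^ i) * Z"
      using s by simp
    also have "\<dots> \<le> real DIM('a) * Z"
    proof (intro mult_right_mono)
      have "(\<Sum>i<DIM('a). s ^ i) \<le> (\<Sum>i<DIM('a). 1)"
        using s by (intro sum_mono power_le_one) auto
      then show "(\<Sum>i<DIM('a). s ^ i) \<le> real DIM('a)" by simp
    qed (use Z_pos in simp)
    finally show ?thesis .
  qed
  have "1 ^ (DIM('a) + 1) * (m * M2) \<le> real DIM('a) * Z"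
  proof (rule tendsto_le[OF _ tendsto_const])
    show "((\<lambda>s::real. s ^ (DIM('a) + 1) * (m * M2)) \<longlongrightarrow> 1 ^ (DIM('a) + 1) * (m * M2)) (at_left 1)"
      by (intro tendsto_intros)
    show "\<forall>\<^sub>F s in at_left (1::real). s ^ (DIM('a) + 1) * (m * M2) \<le> real DIM('a) * Z"
      unfolding eventually_at_left_field using bound zero_less_one by blast
  qed simp
  then have "1 / Z * M2 \<le> real DIM('a) / m"
    using Z_pos m_pos by (simp add: field_simps)
  moreover have "(\<integral>\<^sup>+y. ennreal ((norm (y - minimizer U))\<^sup>2) \<partial>gibbs U) = ennreal (1 / Z * M2)"
    using M2 Z_pos W_pos unfolding M_def
    by (subst gibbs_centered) (auto simp: less_imp_le simp flip: ennreal_mult W_def)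
  ultimately show ?thesis by (simp add: ennreal_leI)
qed

end

section \<open>Random-walk Metropolis\<close>

abbreviation unif :: "real measure" where
  "unif \<equiv> uniform_measure lborel {0..1}"

interpretation unif: prob_space unif
  by (rule prob_space_uniform_measure) auto

lemma nn_integral_unif_threshold:
  assumes "0 \<le> a" "a \<le> 1"
  shows "(\<integral>\<^sup>+u. (if u \<le> a then A else B) \<partial>unif) = ennreal a * A + ennreal (1 - a) * B"
proof -
  have "(\<integral>\<^sup>+u. (if u \<le> a then A else B) \<partial>unif)
      = (\<integral>\<^sup>+u. (if u \<le> a then A else B) * indicator {0..1} u \<partial>lborel)"
    by (subst nn_integral_uniform_measure) (auto simp: divide_ennreal_def)
  also have "\<dots> = (\<integral>\<^sup>+u. A * indicator {0..a} u + B * indicator {a<..1} u \<partial>lborel)"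
    using assms by (intro nn_integral_cong) (auto split: split_indicator)
  also have "\<dots> = A * ennreal a + B * ennreal (1 - a)"
    using assms by (simp add: nn_integral_add nn_integral_cmult_indicator)
  finally show ?thesis by (simp add: mult.commute)
qed

lemma std_gaussian_UNIV [simp]:
  "emeasure (std_gaussian :: 'a::euclidean_space measure) UNIV = 1"
  "measure (std_gaussian :: 'a measure) UNIV = 1"
  using std_gaussian.emeasure_space_1[where 'a='a] std_gaussian.prob_space[where 'a='a] by simp_all

text \<open>The Gaussian component is shared by the Langevin increment and the Metropolis proposal;
  the uniform component decides on acceptance.\<close>

abbreviation noise :: "('a::euclidean_space \<times> real) measure" where
  "noise \<equiv> std_gaussian \<Otimes>\<^sub>M unif"

lemma prob_space_noise: "prob_space (noise :: ('a::euclidean_space \<times> real) measure)"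
  by (rule prob_space_pair) unfold_locales

lemma nn_integral_noise_threshold:
  fixes a :: "'a::euclidean_space \<Rightarrow> real"
  assumes [measurable]: "a \<in> borel_measurable borel" "f \<in> borel_measurable borel" "g \<in> borel_measurable borel"
    and a: "\<And>z. 0 \<le> a z" "\<And>z. a z \<le> 1"
  shows "(\<integral>\<^sup>+(z, u). (if u \<le> a z then f z else g z) \<partial>noise)
    = (\<integral>\<^sup>+z. ennreal (a z) * f z + ennreal (1 - a z) * g z \<partial>std_gaussian)"
proof -
  have "(\<integral>\<^sup>+(z, u). (if u \<le> a z then f z else g z) \<partial>noise)
    = (\<integral>\<^sup>+z. \<integral>\<^sup>+u. (if u \<le> a z then f z else g z) \<partial>unif \<partial>std_gaussian)"
    by (subst unif.nn_integral_fst[symmetric]) (auto simp: case_prod_beta' cong: if_cong)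
  then show ?thesis by (simp add: nn_integral_unif_threshold a)
qed

section \<open>Expansion of the rejection probability\<close>

lemma exp_minus_le_quadratic:
  fixes q :: real
  assumes "q \<ge> 0"
  shows "exp (- q) \<le> 1 - q + q\<^sup>2 / 2"
proof -
  \<comment> \<open>The two quadratic Taylor polynomials multiply to at least 1, so the upper bound
    for \<open>exp (- q)\<close> follows from the lower bound for \<open>exp q\<close>.\<close>
  have "(1 + q + q\<^sup>2 / 2) * (1 - q + q\<^sup>2 / 2) = 1 + (q\<^sup>2 / 2)\<^sup>2"
    by (simp add: algebra_simps power2_eq_square)
  then have "1 \<le> (1 + q + q\<^sup>2 / 2) * (1 - q + q\<^sup>2 / 2)"
    by simp
  also have "\<dots> \<le> exp q * (1 - q + q\<^sup>2 / 2)"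
  proof (rule mult_right_mono)
    have "0 \<le> ((1 - q)\<^sup>2 + 1) / 2" by simp
    also have "\<dots> = 1 - q + q\<^sup>2 / 2" by (simp add: power2_eq_square field_simps)
    finally show "0 \<le> 1 - q + q\<^sup>2 / 2" .
  qed (rule exp_lower_Taylor_quadratic[OF assms])
  finally show ?thesis by (simp add: exp_minus field_simps)
qed

text \<open>Here \<open>r\<close> is the actual increase of energy and \<open>q\<close> its
  linearisation. The upper estimate of the rejection probability is
  \<open>1 - exp (- r) \<le> r\<close>; the lower one is the quadratic bound on
  \<open>exp (- q)\<close>.\<close>

lemma rejection_expansion:
  fixes q r e :: real
  assumes "q \<le> r" "r \<le> q + e" "0 \<le> e"
  shows "\<bar>1 - min 1 (exp (- r)) - max 0 q\<bar> \<le> e + q\<^sup>2 / 2"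
proof -
  have "1 - exp (- r) \<le> r" using exp_ge_add_one_self[of "- r"] by simp
  then have "1 - min 1 (exp (- r)) \<le> max 0 q + e" using assms by auto
  moreover have "max 0 q - q\<^sup>2 / 2 \<le> 1 - min 1 (exp (- r))"
  proof (cases "q \<ge> 0")
    case True
    have "exp (- r) \<le> exp (- q)" using assms by simp
    with exp_minus_le_quadratic[OF True] have "q - q\<^sup>2 / 2 \<le> 1 - min 1 (exp (- r))"
      using min.cobounded2[of 1 "exp (- r)"] by linarith
    with True show ?thesis by (simp add: max_def)
  next
    case False
    then have "max 0 q - q\<^sup>2 / 2 \<le> 0" by simp
    also have "0 \<le> 1 - min 1 (exp (- r))" by simp
    finally show ?thesis .
  qed
  moreover have "0 \<le> q\<^sup>2 / 2" by simp
  ultimately show ?thesis using assms by (intro abs_leI) linarith+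
qed

text \<open>Only the half space on which \<open>g \<bullet> z\<close> is positive contributes, which is half of the covariance.\<close>

lemma integral_std_gaussian_half:
  fixes g D :: "'a::euclidean_space"
  shows "integrable std_gaussian (\<lambda>z. max 0 (g \<bullet> z) * (D \<bullet> z))"
    and "(\<integral>z. max 0 (g \<bullet> z) * (D \<bullet> z) \<partial>std_gaussian) = g \<bullet> D / 2"
proof -
  show int: "integrable std_gaussian (\<lambda>z. max 0 (g \<bullet> z) * (D \<bullet> z))"
  proof (rule Bochner_Integration.integrable_bound[OF integrable_std_gaussian_inner2[of g D]])
    show "AE z in std_gaussian. norm (max 0 (g \<bullet> z) * (D \<bullet> z)) \<le> norm ((g \<bullet> z) * (D \<bullet> z))"
      by (intro always_eventually allI) (auto simp: abs_mult intro!: mult_right_mono)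
  qed simp
  have int': "integrable std_gaussian (\<lambda>z. max 0 (g \<bullet> - z) * (D \<bullet> - z))"
  proof (rule Bochner_Integration.integrable_bound[OF integrable_std_gaussian_inner2[of g D]])
    show "AE z in std_gaussian. norm (max 0 (g \<bullet> - z) * (D \<bullet> - z)) \<le> norm ((g \<bullet> z) * (D \<bullet> z))"
      by (intro always_eventually allI) (auto simp: abs_mult intro!: mult_right_mono)
  qed simp
  have "(\<integral>z. max 0 (g \<bullet> - z) * (D \<bullet> - z) \<partial>std_gaussian) = (\<integral>z. max 0 (g \<bullet> z) * (D \<bullet> z) \<partial>std_gaussian)"
    by (rule integral_std_gaussian_uminus[of "\<lambda>z. max 0 (g \<bullet> z) * (D \<bullet> z)"]) simp
  \<comment> \<open>Averaging over \<open>z\<close> and \<open>- z\<close> replaces the positive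
    part by \<open>g \<bullet> z\<close> itself, which accounts for the factor 2.\<close>
  then have "2 * (\<integral>z. max 0 (g \<bullet> z) * (D \<bullet> z) \<partial>std_gaussian)
    = (\<integral>z. max 0 (g \<bullet> z) * (D \<bullet> z) + max 0 (g \<bullet> - z) * (D \<bullet> - z) \<partial>std_gaussian)"
    using int int' by simp
  also have "\<dots> = (\<integral>z. (g \<bullet> z) * (D \<bullet> z) \<partial>std_gaussian)"
    by (intro Bochner_Integration.integral_cong) (auto simp: max_def)
  finally show "(\<integral>z. max 0 (g \<bullet> z) * (D \<bullet> z) \<partial>std_gaussian) = g \<bullet> D / 2"
    by (simp add: integral_std_gaussian_inner2)
qed

section \<open>Detailed balance and invariance of the Gibbs measure\<close>

context strongly_convex_potential
begin

text \<open>The second argument is the increment, not the proposed point. Gaussian proposals are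
  symmetric, so only the ratio of Gibbs weights enters.\<close>

definition accept :: "'a \<Rightarrow> 'a \<Rightarrow> real" where
  "accept y h = min 1 (exp (U y - U (y + h)))"

lemma accept_measurable [measurable (raw)]:
  assumes [measurable]: "f \<in> borel_measurable M" "g \<in> borel_measurable M"
  shows "(\<lambda>x. accept (f x) (g x)) \<in> borel_measurable M"
  unfolding accept_def by measurable

lemma accept_bounds: "0 \<le> accept y h" "accept y h \<le> 1"
  by (simp_all add: accept_def)

text \<open>Both sides are the minimum of the two Gibbs weights, which is symmetric in the
  endpoints.\<close>

lemma accept_reverse: "exp (- U y) * accept y h = exp (- U (y + h)) * accept (y + h) (- h)"
proof -
  have "exp (- U y) * accept y h = min (exp (- U y)) (exp (- U (y + h)))"
    by (simp add: accept_def min_mult_distrib_left flip: exp_add)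
  moreover have "exp (- U (y + h)) * accept (y + h) (- h) = min (exp (- U (y + h))) (exp (- U y))"
    by (simp add: accept_def min_mult_distrib_left flip: exp_add)
  ultimately show ?thesis by (simp add: min.commute)
qed

text \<open>Translating \<open>y\<close> by the increment exchanges the endpoints of a move, and
  reflecting \<open>z\<close> restores the sign of the increment. Lebesgue measure and the Gaussian
  density absorb these two changes.\<close>

lemma detailed_balance:
  fixes f :: "'a \<Rightarrow> ennreal"
  assumes [measurable]: "f \<in> borel_measurable borel"
  shows "(\<integral>\<^sup>+y. \<integral>\<^sup>+z. ennreal (accept y (s *\<^sub>R z)) * f (y + s *\<^sub>R z) \<partial>std_gaussian \<partial>gibbs U)
    = (\<integral>\<^sup>+y. \<integral>\<^sup>+z. ennreal (accept y (s *\<^sub>R z)) * f y \<partial>std_gaussian \<partial>gibbs U)"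
proof -
  define k where "k y h = ennreal (exp (- U y) * accept y h)" for y h
  have [measurable]: "(\<lambda>x. k (a x) (b x)) \<in> borel_measurable M"
    if [measurable]: "a \<in> borel_measurable M" "b \<in> borel_measurable M" for a b and M :: "'c measure"
    unfolding k_def by measurable
  have k_reverse: "k (y - h) h = k y (- h)" for y h
    using accept_reverse[of "y - h" h] by (simp add: k_def)
  \<comment> \<open>The increment is integrated outermost, so that the translation in
    \<open>y\<close> can be made with \<open>z\<close> fixed.\<close>
  have expand: "(\<integral>\<^sup>+y. \<integral>\<^sup>+z. ennreal (accept y (s *\<^sub>R z)) * F y z \<partial>std_gaussian \<partial>gibbs U)
    = ennreal (1 / Z) * (\<integral>\<^sup>+z. ennreal (gaussian_density 1 z) * (\<integral>\<^sup>+y. k y (s *\<^sub>R z) * F y z \<partial>lborel) \<partial>lborel)"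
    if [measurable]: "(\<lambda>(y, z). F y z) \<in> borel_measurable (borel \<Otimes>\<^sub>M borel)" for F
  proof -
    have "(\<integral>\<^sup>+y. \<integral>\<^sup>+z. ennreal (accept y (s *\<^sub>R z)) * F y z \<partial>std_gaussian \<partial>gibbs U)
      = ennreal (1 / Z) * (\<integral>\<^sup>+y. \<integral>\<^sup>+z. ennreal (exp (- U y)) *
          (ennreal (gaussian_density 1 z) * (ennreal (accept y (s *\<^sub>R z)) * F y z)) \<partial>lborel \<partial>lborel)"
      by (simp add: nn_integral_gibbs nn_integral_gaussian nn_integral_cmult)
    also have "\<dots> = ennreal (1 / Z) * (\<integral>\<^sup>+y. \<integral>\<^sup>+z. ennreal (gaussian_density 1 z) *
          (k y (s *\<^sub>R z) * F y z) \<partial>lborel \<partial>lborel)"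
      by (simp add: k_def ennreal_mult accept_bounds mult_ac)
    also have "\<dots> = ennreal (1 / Z) * (\<integral>\<^sup>+z. \<integral>\<^sup>+y. ennreal (gaussian_density 1 z) *
          (k y (s *\<^sub>R z) * F y z) \<partial>lborel \<partial>lborel)"
      by (subst lborel_pair.Fubini') auto
    finally show ?thesis by (simp add: nn_integral_cmult)
  qed
  have "(\<integral>\<^sup>+y. k y (s *\<^sub>R z) * f (y + s *\<^sub>R z) \<partial>lborel) = (\<integral>\<^sup>+y. k y (- (s *\<^sub>R z)) * f y \<partial>lborel)" for z
  proof -
    have "(\<integral>\<^sup>+y. k y (s *\<^sub>R z) * f (y + s *\<^sub>R z) \<partial>lborel)
      = (\<integral>\<^sup>+y. k (y + - (s *\<^sub>R z)) (s *\<^sub>R z) * f (y + - (s *\<^sub>R z) + s *\<^sub>R z) \<partial>lborel)"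
      by (rule nn_integral_lborel_shift[symmetric]) measurable
    then show ?thesis by (simp add: k_reverse)
  qed
  then have "(\<integral>\<^sup>+z. ennreal (gaussian_density 1 z) * (\<integral>\<^sup>+y. k y (s *\<^sub>R z) * f (y + s *\<^sub>R z) \<partial>lborel) \<partial>lborel)
    = (\<integral>\<^sup>+z. ennreal (gaussian_density 1 z) * (\<integral>\<^sup>+y. k y (- (s *\<^sub>R z)) * f y \<partial>lborel) \<partial>lborel)"
    by simp
  also have "\<dots> = (\<integral>\<^sup>+z. ennreal (gaussian_density 1 (- z)) * (\<integral>\<^sup>+y. k y (- (s *\<^sub>R - z)) * f y \<partial>lborel) \<partial>lborel)"
    by (rule nn_integral_lborel_uminus[symmetric]) measurable
  also have "\<dots> = (\<integral>\<^sup>+z. ennreal (gaussian_density 1 z) * (\<integral>\<^sup>+y. k y (s *\<^sub>R z) * f y \<partial>lborel) \<partial>lborel)"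
    by simp
  finally show ?thesis
    by (simp add: expand)
qed

definition rwm :: "real \<Rightarrow> 'a \<Rightarrow> 'a \<times> real \<Rightarrow> 'a" where
  "rwm s y w = (if snd w \<le> accept y (s *\<^sub>R fst w) then y + s *\<^sub>R fst w else y)"

lemma rwm_measurable [measurable (raw)]:
  assumes [measurable]: "f \<in> borel_measurable M" "g \<in> measurable M (borel \<Otimes>\<^sub>M borel)"
  shows "(\<lambda>x. rwm s (f x) (g x)) \<in> borel_measurable M"
  unfolding rwm_def by measurable

text \<open>By detailed balance the mass accepted into a point equals the mass accepted out of it;
  the latter and the rejected mass add up to 1.\<close>

lemma rwm_invariant:
  fixes f :: "'a \<Rightarrow> ennreal"
  assumes [measurable]: "f \<in> borel_measurable borel"
  shows "(\<integral>\<^sup>+y. \<integral>\<^sup>+w. f (rwm s y w) \<partial>noise \<partial>gibbs U) = (\<integral>\<^sup>+y. f y \<partial>gibbs U)"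
proof -
  have inner: "(\<integral>\<^sup>+w. f (rwm s y w) \<partial>noise)
      = (\<integral>\<^sup>+z. ennreal (accept y (s *\<^sub>R z)) * f (y + s *\<^sub>R z) \<partial>std_gaussian)
        + (\<integral>\<^sup>+z. ennreal (1 - accept y (s *\<^sub>R z)) * f y \<partial>std_gaussian)" for y
  proof -
    have "(\<integral>\<^sup>+w. f (rwm s y w) \<partial>noise)
      = (\<integral>\<^sup>+(z, u). (if u \<le> accept y (s *\<^sub>R z) then f (y + s *\<^sub>R z) else f y) \<partial>noise)"
      by (intro nn_integral_cong) (auto simp: rwm_def)
    also have "\<dots> = (\<integral>\<^sup>+z. ennreal (accept y (s *\<^sub>R z)) * f (y + s *\<^sub>R z)
          + ennreal (1 - accept y (s *\<^sub>R z)) * f y \<partial>std_gaussian)"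
      by (rule nn_integral_noise_threshold) (auto simp: accept_bounds)
    finally show ?thesis by (simp add: nn_integral_add)
  qed
  have "(\<integral>\<^sup>+y. \<integral>\<^sup>+w. f (rwm s y w) \<partial>noise \<partial>gibbs U)
    = (\<integral>\<^sup>+y. \<integral>\<^sup>+z. ennreal (accept y (s *\<^sub>R z)) * f (y + s *\<^sub>R z) \<partial>std_gaussian \<partial>gibbs U)
      + (\<integral>\<^sup>+y. \<integral>\<^sup>+z. ennreal (1 - accept y (s *\<^sub>R z)) * f y \<partial>std_gaussian \<partial>gibbs U)"
    by (simp add: inner nn_integral_add)
  also have "\<dots> = (\<integral>\<^sup>+y. \<integral>\<^sup>+z. ennreal (accept y (s *\<^sub>R z)) * f y \<partial>std_gaussian \<partial>gibbs U)
      + (\<integral>\<^sup>+y. \<integral>\<^sup>+z. ennreal (1 - accept y (s *\<^sub>R z)) * f y \<partial>std_gaussian \<partial>gibbs U)"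
    by (simp add: detailed_balance)
  also have "\<dots> = (\<integral>\<^sup>+y. \<integral>\<^sup>+z. (ennreal (accept y (s *\<^sub>R z)) + ennreal (1 - accept y (s *\<^sub>R z))) * f y
      \<partial>std_gaussian \<partial>gibbs U)"
    by (simp add: nn_integral_add distrib_right)
  also have "\<dots> = (\<integral>\<^sup>+y. f y \<partial>gibbs U)"
    by (simp add: accept_bounds flip: ennreal_plus)
  finally show ?thesis .
qed

section \<open>Squared distance under a shared proposal\<close>

definition c3 :: real where "c3 = (\<integral>z. norm (z::'a) ^ 3 \<partial>std_gaussian)"

definition c4 :: real where "c4 = (\<integral>z. norm (z::'a) ^ 4 \<partial>std_gaussian)"

text \<open>The coefficient of \<open>s ^ 3\<close> in \<open>rwm_coupling\<close>. It depends on
  the stationary chain only, so its expectation is the same at every step. The last summand comes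
  from absorbing the cubic term that contains the distance of the chains.\<close>

definition rwm_error :: "'a \<Rightarrow> real" where
  "rwm_error y = norm (gradU y) * c3 + L / 2 * c4 + ((L + (norm (gradU y))\<^sup>2) * c3)\<^sup>2 / (2 * m)"

lemma rwm_error_measurable [measurable]: "rwm_error \<in> borel_measurable borel"
  unfolding rwm_error_def[abs_def] by measurable

lemma c3_nonneg: "0 \<le> c3" and c4_nonneg: "0 \<le> c4"
  unfolding c3_def c4_def by (auto intro!: integral_nonneg_AE)

lemma rwm_error_nonneg: "0 \<le> rwm_error y"
  using c3_nonneg c4_nonneg L_nonneg m_pos by (simp add: rwm_error_def)

text \<open>Convexity bounds the energy increase below by \<open>q\<close>, the descent lemma bounds
  it above. The sharp estimate is for the drift, the crude one for the term that already carries the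
  squared increment.\<close>

lemma rejection_bounds:
  fixes y h :: 'a
  defines "q \<equiv> gradU y \<bullet> h"
  shows "\<bar>1 - accept y h - max 0 q\<bar> \<le> L / 2 * (norm h)\<^sup>2 + q\<^sup>2 / 2"
    and "1 - accept y h \<le> norm (gradU y) * norm h + L / 2 * (norm h)\<^sup>2"
proof -
  define r where "r = U (y + h) - U y"
  have acc: "accept y h = min 1 (exp (- r))" by (simp add: accept_def r_def)
  have r1: "q \<le> r"
  proof -
    have "0 \<le> m / 2 * (norm (y - (y + h)))\<^sup>2" using m_pos by simp
    then show ?thesis
      using strongly_convex[of y "y + h"] by (simp add: q_def r_def)
  qed
  have r2: "r \<le> q + L / 2 * (norm h)\<^sup>2"
    using U_le_quadratic[of "y + h" y] by (simp add: q_def r_def)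
  show "\<bar>1 - accept y h - max 0 q\<bar> \<le> L / 2 * (norm h)\<^sup>2 + q\<^sup>2 / 2"
    unfolding acc using rejection_expansion[OF r1 r2] L_nonneg by simp
  have "q \<le> norm (gradU y) * norm h" unfolding q_def by (rule norm_cauchy_schwarz)
  moreover have "1 - exp (- r) \<le> r" using exp_ge_add_one_self[of "- r"] by simp
  moreover have "0 \<le> norm (gradU y) * norm h + L / 2 * (norm h)\<^sup>2" using L_nonneg by simp
  ultimately show "1 - accept y h \<le> norm (gradU y) * norm h + L / 2 * (norm h)\<^sup>2"
    unfolding acc using r2 by (simp add: min_def)
qed

text \<open>Upon acceptance both chains move by the same increment and \<open>D\<close> stays; upon
  rejection it becomes \<open>D + s *\<^sub>R z\<close>. So the rejection probability multiplies the
  change of the square, and replacing it by the positive part of its linearisation leaves terms of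
  order three and four in \<open>s\<close>.\<close>

lemma rwm_coupling_pointwise:
  fixes D y z :: 'a
  assumes s: "0 < s"
  shows "accept y (s *\<^sub>R z) * (norm D)\<^sup>2 + (1 - accept y (s *\<^sub>R z)) * (norm (D + s *\<^sub>R z))\<^sup>2
    \<le> (norm D)\<^sup>2 + 2 * s\<^sup>2 * (max 0 (gradU y \<bullet> z) * (D \<bullet> z))
      + s ^ 3 * (norm D * (L + (norm (gradU y))\<^sup>2) + norm (gradU y)) * norm z ^ 3
      + s ^ 4 * (L / 2) * norm z ^ 4"
proof -
  define h where "h = s *\<^sub>R z"
  define \<rho> where "\<rho> = 1 - accept y h"
  define q where "q = gradU y \<bullet> h"
  have rho: "0 \<le> \<rho>" by (simp add: \<rho>_def accept_bounds)
  have nh: "norm h = s * norm z" using s by (simp add: h_def)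
  have q: "q\<^sup>2 \<le> (norm (gradU y))\<^sup>2 * (norm h)\<^sup>2"
    unfolding q_def power_mult_distrib[symmetric]
    by (rule abs_le_square_iff[THEN iffD1]) (simp add: Cauchy_Schwarz_ineq2)
  have "(\<rho> - max 0 q) * (D \<bullet> h) \<le> \<bar>\<rho> - max 0 q\<bar> * \<bar>D \<bullet> h\<bar>"
    unfolding abs_mult[symmetric] by (rule abs_ge_self)
  also have "\<dots> \<le> (L / 2 * (norm h)\<^sup>2 + (norm (gradU y))\<^sup>2 * (norm h)\<^sup>2 / 2) * (norm D * norm h)"
  proof (intro mult_mono Cauchy_Schwarz_ineq2)
    show "\<bar>\<rho> - max 0 q\<bar> \<le> L / 2 * (norm h)\<^sup>2 + (norm (gradU y))\<^sup>2 * (norm h)\<^sup>2 / 2"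
      using rejection_bounds(1)[of y h] q by (simp add: \<rho>_def q_def)
  qed (use L_nonneg in auto)
  finally have "2 * \<rho> * (D \<bullet> h) \<le> 2 * (max 0 q * (D \<bullet> h)) + norm D * (L + (norm (gradU y))\<^sup>2) * norm h ^ 3"
    by (simp add: algebra_simps power2_eq_square power3_eq_cube)
  moreover have "\<rho> * (norm h)\<^sup>2 \<le> (norm (gradU y) * norm h + L / 2 * (norm h)\<^sup>2) * (norm h)\<^sup>2"
    using rejection_bounds(2)[of y h] by (intro mult_right_mono) (auto simp: \<rho>_def)
  moreover have "(norm (D + h))\<^sup>2 = (norm D)\<^sup>2 + 2 * (D \<bullet> h) + (norm h)\<^sup>2"
    unfolding power2_norm_eq_inner by (simp add: inner_add_left inner_add_right inner_commute)
  then have "(1 - \<rho>) * (norm D)\<^sup>2 + \<rho> * (norm (D + h))\<^sup>2 = (norm D)\<^sup>2 + 2 * \<rho> * (D \<bullet> h) + \<rho> * (norm h)\<^sup>2"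
    by (simp add: algebra_simps)
  ultimately have main: "(1 - \<rho>) * (norm D)\<^sup>2 + \<rho> * (norm (D + h))\<^sup>2
    \<le> (norm D)\<^sup>2 + 2 * (max 0 q * (D \<bullet> h))
      + (norm D * (L + (norm (gradU y))\<^sup>2) + norm (gradU y)) * norm h ^ 3 + (L / 2) * norm h ^ 4"
    by (simp add: algebra_simps power2_eq_square power3_eq_cube power4_eq_xxxx)
  have "max 0 q = s * max 0 (gradU y \<bullet> z)"
    using s by (simp add: q_def h_def max_def zero_le_mult_iff)
  then have eq: "max 0 q * (D \<bullet> h) = s\<^sup>2 * (max 0 (gradU y \<bullet> z) * (D \<bullet> z))"
    by (simp add: h_def power2_eq_square mult_ac)
  show ?thesis
    using main unfolding eq unfolding \<rho>_def nh power_mult_distrib unfolding h_def by (simp add: mult_ac)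
qed

text \<open>The half-space integral makes the leading term
  \<open>s\<^sup>2 * (g \<bullet> D)\<close>. Strong convexity bounds it by
  \<open>s\<^sup>2 * (V p - V y)\<close> minus a multiple of the squared distance, and this negative
  square absorbs the cubic error proportional to \<open>norm D\<close>.\<close>

lemma rwm_coupling:
  assumes s: "0 < s" "s \<le> 1"
  shows "(\<integral>\<^sup>+w. ennreal ((norm (p + s *\<^sub>R fst w - rwm s y w))\<^sup>2) \<partial>noise) + ennreal (s\<^sup>2) * ennreal (V y)
    \<le> ennreal ((norm (p - y))\<^sup>2) + ennreal (s\<^sup>2) * ennreal (V p) + ennreal (s ^ 3) * ennreal (rwm_error y)"
proof -
  define D where "D = p - y"
  define g where "g = gradU y"
  define B where "B z = (norm D)\<^sup>2 + 2 * s\<^sup>2 * (max 0 (g \<bullet> z) * (D \<bullet> z))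
      + s ^ 3 * (norm D * (L + (norm g)\<^sup>2) + norm g) * norm z ^ 3 + s ^ 4 * (L / 2) * norm z ^ 4" for z
  have pt: "accept y (s *\<^sub>R z) * (norm D)\<^sup>2 + (1 - accept y (s *\<^sub>R z)) * (norm (D + s *\<^sub>R z))\<^sup>2 \<le> B z" for z
    unfolding B_def g_def by (rule rwm_coupling_pointwise[OF s(1)])
  have B_nonneg: "0 \<le> B z" for z
    by (rule order_trans[OF _ pt]) (simp add: accept_bounds)
  note int = integral_std_gaussian_half(1)[of g D]
    integrable_std_gaussian_norm_power[of 3, where 'a='a] integrable_std_gaussian_norm_power[of 4, where 'a='a]
  have int_B: "integrable std_gaussian B"
    unfolding B_def[abs_def] using int by simp
  have "(\<integral>\<^sup>+w. ennreal ((norm (p + s *\<^sub>R fst w - rwm s y w))\<^sup>2) \<partial>noise)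
    = (\<integral>\<^sup>+(z, u). (if u \<le> accept y (s *\<^sub>R z) then ennreal ((norm D)\<^sup>2) else ennreal ((norm (D + s *\<^sub>R z))\<^sup>2)) \<partial>noise)"
    by (intro nn_integral_cong) (auto simp: rwm_def D_def algebra_simps)
  also have "\<dots> = (\<integral>\<^sup>+z. ennreal (accept y (s *\<^sub>R z)) * ennreal ((norm D)\<^sup>2)
      + ennreal (1 - accept y (s *\<^sub>R z)) * ennreal ((norm (D + s *\<^sub>R z))\<^sup>2) \<partial>std_gaussian)"
    by (rule nn_integral_noise_threshold) (auto simp: accept_bounds)
  also have "\<dots> \<le> (\<integral>\<^sup>+z. ennreal (B z) \<partial>std_gaussian)"
    using pt by (intro nn_integral_mono) (simp add: accept_bounds ennreal_leI flip: ennreal_mult ennreal_plus)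
  also have "\<dots> = ennreal (\<integral>z. B z \<partial>std_gaussian)"
    using int_B B_nonneg by (intro nn_integral_eq_integral) auto
  finally have step: "(\<integral>\<^sup>+w. ennreal ((norm (p + s *\<^sub>R fst w - rwm s y w))\<^sup>2) \<partial>noise)
    \<le> ennreal (\<integral>z. B z \<partial>std_gaussian)" .
  have "(\<integral>z. B z \<partial>std_gaussian) = (norm D)\<^sup>2 + s\<^sup>2 * (g \<bullet> D)
      + s ^ 3 * (norm D * (L + (norm g)\<^sup>2) + norm g) * c3 + s ^ 4 * (L / 2) * c4"
    unfolding B_def using int
    by (simp add: integral_std_gaussian_half(2) c3_def c4_def)
  also have "\<dots> + s\<^sup>2 * V y \<le> (norm D)\<^sup>2 + s\<^sup>2 * V p + s ^ 3 * rwm_error y"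
  proof -
    have "s\<^sup>2 * (g \<bullet> D) \<le> s\<^sup>2 * (V p - V y - m / 2 * (norm D)\<^sup>2)"
      using strongly_convex[of y p] by (intro mult_left_mono) (auto simp: g_def D_def V_def norm_minus_commute)
    moreover define a where "a = (L + (norm g)\<^sup>2) * c3"
    have "s ^ 3 * (norm D * a) \<le> s\<^sup>2 * (m / 2 * (norm D)\<^sup>2) + s ^ 4 * (a\<^sup>2 / (2 * m))"
    proof -
      \<comment> \<open>Young's inequality, weighted so that the term in
        \<open>(norm D)\<^sup>2\<close> is exactly the one supplied by strong convexity.\<close>
      have "0 \<le> s\<^sup>2 / (2 * m) * (m * norm D - s * a)\<^sup>2" using m_pos by simp
      also have "\<dots> = s\<^sup>2 * (m / 2 * (norm D)\<^sup>2) + s ^ 4 * (a\<^sup>2 / (2 * m)) - s ^ 3 * (norm D * a)"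
        using m_pos by (simp add: field_simps power2_eq_square power3_eq_cube power4_eq_xxxx)
      finally show ?thesis by simp
    qed
    \<comment> \<open>As \<open>s \<le> 1\<close>, quartic terms may be counted as cubic, and a
      single error coefficient suffices.\<close>
    moreover have "s ^ 4 * (a\<^sup>2 / (2 * m)) \<le> s ^ 3 * (a\<^sup>2 / (2 * m))"
      using s m_pos by (intro mult_right_mono power_decreasing) auto
    moreover have "s ^ 4 * (L / 2 * c4) \<le> s ^ 3 * (L / 2 * c4)"
      using s L_nonneg c4_nonneg by (intro mult_right_mono power_decreasing) auto
    moreover have "s ^ 3 * (norm D * (L + (norm g)\<^sup>2) + norm g) * c3 = s ^ 3 * (norm D * a) + s ^ 3 * (norm g * c3)"
      by (simp add: a_def algebra_simps)
    moreover have "s ^ 3 * rwm_error y = s ^ 3 * (norm g * c3) + s ^ 3 * (L / 2 * c4) + s ^ 3 * (a\<^sup>2 / (2 * m))"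
      by (simp add: rwm_error_def a_def g_def algebra_simps)
    ultimately show ?thesis by (simp add: right_diff_distrib)
  qed
  finally have real: "(\<integral>z. B z \<partial>std_gaussian) + s\<^sup>2 * V y \<le> (norm D)\<^sup>2 + s\<^sup>2 * V p + s ^ 3 * rwm_error y" .
  have "(\<integral>\<^sup>+w. ennreal ((norm (p + s *\<^sub>R fst w - rwm s y w))\<^sup>2) \<partial>noise) + ennreal (s\<^sup>2) * ennreal (V y)
    \<le> ennreal (\<integral>z. B z \<partial>std_gaussian) + ennreal (s\<^sup>2) * ennreal (V y)"
    using step by (rule add_right_mono)
  also have "\<dots> = ennreal ((\<integral>z. B z \<partial>std_gaussian) + s\<^sup>2 * V y)"
    using V_nonneg B_nonneg by (simp add: ennreal_mult integral_nonneg_AE)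
  also have "\<dots> \<le> ennreal ((norm D)\<^sup>2 + s\<^sup>2 * V p + s ^ 3 * rwm_error y)"
    using real by (rule ennreal_leI)
  also have "\<dots> = ennreal ((norm D)\<^sup>2) + ennreal (s\<^sup>2) * ennreal (V p) + ennreal (s ^ 3) * ennreal (rwm_error y)"
    using s V_nonneg rwm_error_nonneg by (simp add: ennreal_mult)
  finally show ?thesis by (simp add: D_def)
qed

text \<open>The gradient grows at most linearly away from the minimizer, so the error is at most
  quartic and the fourth Gibbs moment controls it.\<close>

lemma gibbs_rwm_error_finite: "(\<integral>\<^sup>+y. ennreal (rwm_error y) \<partial>gibbs U) < \<infinity>"
proof -
  interpret gibbs: prob_space "gibbs U" by (rule prob_space_gibbs)
  define C where "C = L * c3 + L / 2 * c4 + (2 * L\<^sup>2 + 2 * L ^ 4) * c3\<^sup>2 / (2 * m)"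
  have C: "0 \<le> C" using L_nonneg c3_nonneg c4_nonneg m_pos by (simp add: C_def)
  have bound: "rwm_error y \<le> C * (1 + norm (y - minimizer U) ^ 4)" for y
  proof -
    define r where "r = norm (y - minimizer U)"
    have r: "0 \<le> r" "r \<le> 1 + r ^ 4" using power_le_pow4[of r 1] by (auto simp: r_def)
    have g: "norm (gradU y) \<le> L * r" using norm_gradU_le by (simp add: r_def)
    have "norm (gradU y) * c3 \<le> L * c3 * (1 + r ^ 4)"
      using mult_right_mono[OF order_trans[OF g mult_left_mono[OF r(2) L_nonneg]] c3_nonneg] by (simp add: mult_ac)
    moreover have "L / 2 * c4 \<le> L / 2 * c4 * (1 + r ^ 4)"
      using mult_left_mono[of 1 "1 + r ^ 4" "L / 2 * c4"] L_nonneg c4_nonneg by simp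
    moreover have "((L + (norm (gradU y))\<^sup>2) * c3)\<^sup>2 / (2 * m) \<le> (2 * L\<^sup>2 + 2 * L ^ 4) * c3\<^sup>2 / (2 * m) * (1 + r ^ 4)"
    proof -
      have "(L + (norm (gradU y))\<^sup>2)\<^sup>2 \<le> (L + (L * r)\<^sup>2)\<^sup>2"
        using g L_nonneg r(1) by (intro power_mono add_left_mono) auto
      also have "\<dots> \<le> 2 * L\<^sup>2 + 2 * ((L * r)\<^sup>2)\<^sup>2"
        using sum_squares_bound[of L "(L * r)\<^sup>2"] by (simp add: power2_sum)
      also have "\<dots> = 2 * L\<^sup>2 + 2 * L ^ 4 * r ^ 4"
        by (simp add: power_mult_distrib flip: power_mult)
      also have "\<dots> \<le> (2 * L\<^sup>2 + 2 * L ^ 4) * (1 + r ^ 4)"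
        using L_nonneg r(1) by (simp add: algebra_simps)
      finally have "(L + (norm (gradU y))\<^sup>2)\<^sup>2 * (c3\<^sup>2 / (2 * m)) \<le> (2 * L\<^sup>2 + 2 * L ^ 4) * (1 + r ^ 4) * (c3\<^sup>2 / (2 * m))"
        using m_pos by (intro mult_right_mono) auto
      then show ?thesis by (simp add: power_mult_distrib mult_ac)
    qed
    ultimately show ?thesis unfolding rwm_error_def C_def r_def[symmetric] distrib_right[of _ _ "1 + r ^ 4"]
      by (intro add_mono)
  qed
  have "(\<integral>\<^sup>+y. ennreal (rwm_error y) \<partial>gibbs U)
    \<le> (\<integral>\<^sup>+y. ennreal C * (1 + ennreal (norm (y - minimizer U) ^ 4)) \<partial>gibbs U)"
  proof (intro nn_integral_mono)
    fix y
    have "ennreal (rwm_error y) \<le> ennreal (C * (1 + norm (y - minimizer U) ^ 4))"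
      using bound by (rule ennreal_leI)
    also have "\<dots> = ennreal C * (1 + ennreal (norm (y - minimizer U) ^ 4))"
      using C by (simp add: ennreal_mult)
    finally show "ennreal (rwm_error y) \<le> ennreal C * (1 + ennreal (norm (y - minimizer U) ^ 4))" .
  qed
  also have "\<dots> = ennreal C * (1 + (\<integral>\<^sup>+y. ennreal (norm (y - minimizer U) ^ 4) \<partial>gibbs U))"
    using gibbs.emeasure_space_1 by (simp add: nn_integral_cmult nn_integral_add)
  also have "\<dots> < \<infinity>"
    using gibbs_pow4_finite by (simp add: ennreal_mult_less_top)
  finally show ?thesis .
qed

text \<open>Finiteness is what later allows the stationary energy to be cancelled in
  \<open>ennreal\<close>.\<close>

lemma gibbs_V_finite: "(\<integral>\<^sup>+y. ennreal (V y) \<partial>gibbs U) < \<infinity>"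
proof -
  have "(\<integral>\<^sup>+y. ennreal (V y) \<partial>gibbs U)
    \<le> (\<integral>\<^sup>+y. ennreal (L / 2) * ennreal ((norm (y - minimizer U))\<^sup>2) \<partial>gibbs U)"
    using V_upper L_nonneg by (intro nn_integral_mono) (simp add: ennreal_leI flip: ennreal_mult)
  also have "\<dots> = ennreal (L / 2) * (\<integral>\<^sup>+y. ennreal ((norm (y - minimizer U))\<^sup>2) \<partial>gibbs U)"
    by (rule nn_integral_cmult) measurable
  also have "\<dots> < \<infinity>"
    using gibbs_second_moment by (simp add: ennreal_mult_less_top le_less_trans)
  finally show ?thesis .
qed

end

section \<open>Coupling the Langevin step with the Gibbs measure\<close>

text \<open>\<open>b\<close> grows at most linearly, and \<open>c * k\<^sup>2 + 2 * c * k\<close> is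
  at most \<open>c * (k + 1)\<^sup>2\<close>; hence the quadratic term. Keeping \<open>v\<close> on
  the left avoids truncated subtraction.\<close>

lemma ennreal_iterate_le:
  fixes a b :: "nat \<Rightarrow> ennreal"
  assumes a: "\<And>k. a (Suc k) + v \<le> a k + b k + e"
    and b: "\<And>k. b (Suc k) \<le> b k + ennreal (2 * c)" and c: "0 \<le> c"
  shows "a k + of_nat k * v \<le> a 0 + of_nat k * b 0 + ennreal (c * (real k)\<^sup>2) + of_nat k * e"
proof (induction k)
  case (Suc k)
  have bk: "b k \<le> b 0 + ennreal (2 * c * real k)"
  proof (induction k)
    case (Suc k)
    have "b (Suc k) \<le> b 0 + ennreal (2 * c * real k) + ennreal (2 * c)"
      using b[of k] Suc by (meson add_right_mono order_trans)
    moreover have "ennreal (2 * c * real k) + ennreal (2 * c) = ennreal (2 * c * real (Suc k))"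
      using c by (simp add: distrib_left add.commute flip: ennreal_plus)
    ultimately show ?case by (simp only: add.assoc)
  qed simp
  have sq: "ennreal (c * (real k)\<^sup>2) + ennreal (2 * c * real k) \<le> ennreal (c * (real (Suc k))\<^sup>2)"
    using c by (simp add: algebra_simps power2_eq_square flip: ennreal_plus)
  have "a (Suc k) + of_nat (Suc k) * v = (a (Suc k) + v) + of_nat k * v"
    by (simp add: algebra_simps)
  also have "\<dots> \<le> (a k + b k + e) + of_nat k * v"
    by (intro add_right_mono a)
  also have "\<dots> = (a k + of_nat k * v) + b k + e" by (simp add: algebra_simps)
  also have "\<dots> \<le> (a 0 + of_nat k * b 0 + ennreal (c * (real k)\<^sup>2) + of_nat k * e)
      + (b 0 + ennreal (2 * c * real k)) + e"
    by (intro add_mono Suc bk order_refl)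
  also have "\<dots> = a 0 + of_nat (Suc k) * b 0 + (ennreal (c * (real k)\<^sup>2) + ennreal (2 * c * real k))
      + of_nat (Suc k) * e"
    by (simp add: algebra_simps)
  also have "\<dots> \<le> a 0 + of_nat (Suc k) * b 0 + ennreal (c * (real (Suc k))\<^sup>2) + of_nat (Suc k) * e"
    by (intro add_mono sq order_refl)
  finally show ?case .
qed simp

section \<open>Transport costs, Langevin kernels and marginals\<close>

definition transport_cost :: "('a::euclidean_space \<times> 'a) measure \<Rightarrow> ennreal" where
  "transport_cost \<zeta> = (\<integral>\<^sup>+q. ennreal ((norm (fst q - snd q))\<^sup>2) \<partial>\<zeta>)"

text \<open>Squaring undoes the extended root, also at infinity, so the left side is the infimum of
  the costs.\<close>

lemma wasserstein2_square_le:
  assumes "\<zeta> \<in> couplings \<mu> \<nu>"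
  shows "(wasserstein2 \<mu> \<nu>)\<^sup>2 \<le> transport_cost \<zeta>"
proof -
  define I where "I = (INF \<zeta>\<in>couplings \<mu> \<nu>. \<integral>\<^sup>+ (x, y). ennreal ((norm (x - y))\<^sup>2) \<partial>\<zeta>)"
  have "I \<le> transport_cost \<zeta>"
    unfolding I_def transport_cost_def using assms by (intro INF_lower2) (auto simp: case_prod_beta')
  moreover have "(wasserstein2 \<mu> \<nu>)\<^sup>2 = I"
    unfolding wasserstein2_def I_def[symmetric] ennreal_sqrt_def
    by (cases I) (auto simp: power2_eq_square simp flip: ennreal_mult)
  ultimately show ?thesis by simp
qed

text \<open>The step is the image of one fixed Gaussian under a map jointly measurable in the
  starting point and the noise.\<close>

lemma ula_step_measurable [measurable]:
  assumes h: "0 < h" and [measurable]: "G \<in> borel_measurable borel"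
  shows "ula_step G h \<in> measurable borel (subprob_algebra borel)"
proof -
  have "ula_step G h x = distr std_gaussian borel (\<lambda>z. x - h *\<^sub>R G x + sqrt (2 * h) *\<^sub>R z)" for x
  proof (rule measure_eqI)
    fix A assume "A \<in> sets (ula_step G h x)"
    then have [measurable]: "A \<in> sets borel" by (simp add: ula_step_def)
    let ?a = "x - h *\<^sub>R G x"
    have "emeasure (ula_step G h x) A = (\<integral>\<^sup>+y. indicator A y \<partial>gaussian ?a (2 * h))"
      by (simp add: ula_step_def)
    also have "\<dots> = (\<integral>\<^sup>+z. indicator A (?a + z) \<partial>gaussian 0 (2 * h))"
      by (simp add: nn_integral_gaussian del: nn_integral_indicator)
    also have "\<dots> = (\<integral>\<^sup>+z. indicator A (?a + sqrt (2 * h) *\<^sub>R z) \<partial>std_gaussian)"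
      using nn_integral_gaussian_scale[of "sqrt (2 * h)" "\<lambda>z. indicator A (?a + z)"] h by simp
    also have "\<dots> = (\<integral>\<^sup>+y. indicator A y \<partial>distr std_gaussian borel (\<lambda>z. ?a + sqrt (2 * h) *\<^sub>R z))"
      by (rule nn_integral_distr[symmetric]) measurable
    finally show "emeasure (ula_step G h x) A
      = emeasure (distr std_gaussian borel (\<lambda>z. ?a + sqrt (2 * h) *\<^sub>R z)) A" by simp
  qed (simp add: ula_step_def)
  then have eq: "ula_step G h = (\<lambda>x. distr std_gaussian borel (\<lambda>z. x - h *\<^sub>R G x + sqrt (2 * h) *\<^sub>R z))"
    by auto
  have "(\<lambda>x. std_gaussian :: 'a measure) \<in> measurable borel (subprob_algebra borel)"
    by (intro measurable_const) (simp add: space_subprob_algebra std_gaussian.subprob_space_axioms)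
  then show ?thesis
    unfolding eq by (intro measurable_distr2[where M=borel]) auto
qed

lemma ula_kernel_measurable:
  assumes "\<And>k. k \<ge> 1 \<Longrightarrow> \<gamma> k > 0" and "G \<in> borel_measurable borel"
  shows "ula_kernel G \<gamma> n \<in> measurable borel (subprob_algebra borel)"
proof (induction n)
  case 0
  have "ula_kernel G \<gamma> 0 = return borel" by auto
  then show ?case by simp
next
  case (Suc n)
  have "ula_kernel G \<gamma> (Suc n) = (\<lambda>x. ula_kernel G \<gamma> n x \<bind> ula_step G (\<gamma> (Suc n)))" by auto
  then show ?case
    using measurable_bind2[OF Suc ula_step_measurable] assms by simp
qed

lemma nn_integral_fst_eq_marginal:
  assumes "distr \<zeta> borel fst = \<mu>" "sets \<zeta> = sets (borel \<Otimes>\<^sub>M borel)" "f \<in> borel_measurable borel"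
  shows "(\<integral>\<^sup>+q. f (fst q) \<partial>\<zeta>) = (\<integral>\<^sup>+x. f x \<partial>\<mu>)"
proof -
  have [measurable_cong]: "sets \<zeta> = sets (borel \<Otimes>\<^sub>M borel)" by fact
  show ?thesis
    unfolding assms(1)[symmetric] using assms(3) by (subst nn_integral_distr) auto
qed

lemma nn_integral_snd_eq_marginal:
  assumes "distr \<zeta> borel snd = \<nu>" "sets \<zeta> = sets (borel \<Otimes>\<^sub>M borel)" "f \<in> borel_measurable borel"
  shows "(\<integral>\<^sup>+q. f (snd q) \<partial>\<zeta>) = (\<integral>\<^sup>+y. f y \<partial>\<nu>)"
proof -
  have [measurable_cong]: "sets \<zeta> = sets (borel \<Otimes>\<^sub>M borel)" by fact
  show ?thesis
    unfolding assms(1)[symmetric] using assms(3) by (subst nn_integral_distr) auto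
qed

lemma distr_eqI_nn_integral:
  assumes [measurable]: "T \<in> measurable \<zeta> borel" and sets: "sets \<mu> = sets borel"
    and eq: "\<And>A. A \<in> sets borel \<Longrightarrow> (\<integral>\<^sup>+q. indicator A (T q) \<partial>\<zeta>) = (\<integral>\<^sup>+x. indicator A x \<partial>\<mu>)"
  shows "distr \<zeta> borel T = \<mu>"
proof (rule measure_eqI)
  fix A assume "A \<in> sets (distr \<zeta> borel T)"
  then have A [measurable]: "A \<in> sets borel" by simp
  have "emeasure (distr \<zeta> borel T) A = (\<integral>\<^sup>+x. indicator A x \<partial>distr \<zeta> borel T)" by simp
  also have "\<dots> = (\<integral>\<^sup>+q. indicator A (T q) \<partial>\<zeta>)" by (rule nn_integral_distr) measurable
  also have "\<dots> = emeasure \<mu> A" using eq[OF A] sets by simp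
  finally show "emeasure (distr \<zeta> borel T) A = emeasure \<mu> A" .
qed (simp add: sets)

section \<open>The joint chain of Gaussian increments and Metropolis moves\<close>

context strongly_convex_potential
begin

text \<open>The first coordinate always takes the increment, the second only upon acceptance. The
  gradient drift is no part of this step: it is applied once, before the chain starts.\<close>

definition joint_step :: "real \<Rightarrow> ('a \<times> 'a) measure \<Rightarrow> ('a \<times> 'a) measure" where
  "joint_step s \<zeta> = distr (\<zeta> \<Otimes>\<^sub>M noise) (borel \<Otimes>\<^sub>M borel)
     (\<lambda>(q, w). (fst q + s *\<^sub>R fst w, rwm s (snd q) w))"

lemma sets_joint_step [simp]: "sets (joint_step s \<zeta>) = sets (borel \<Otimes>\<^sub>M borel)"
  by (simp add: joint_step_def)

lemma nn_integral_joint_step: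
  fixes f :: "'a \<times> 'a \<Rightarrow> ennreal"
  assumes sets [measurable_cong]: "sets \<zeta> = sets (borel \<Otimes>\<^sub>M borel)"
    and [measurable]: "f \<in> borel_measurable (borel \<Otimes>\<^sub>M borel)"
  shows "(\<integral>\<^sup>+q. f q \<partial>joint_step s \<zeta>)
    = (\<integral>\<^sup>+q. \<integral>\<^sup>+w. f (fst q + s *\<^sub>R fst w, rwm s (snd q) w) \<partial>noise \<partial>\<zeta>)"
proof -
  interpret noise: prob_space "noise :: ('a \<times> real) measure" by (rule prob_space_noise)
  have "(\<integral>\<^sup>+q. f q \<partial>joint_step s \<zeta>)
    = (\<integral>\<^sup>+x. f (case x of (q, w) \<Rightarrow> (fst q + s *\<^sub>R fst w, rwm s (snd q) w)) \<partial>(\<zeta> \<Otimes>\<^sub>M noise))"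
    unfolding joint_step_def by (rule nn_integral_distr) measurable
  also have "\<dots> = (\<integral>\<^sup>+q. \<integral>\<^sup>+w. f (fst q + s *\<^sub>R fst w, rwm s (snd q) w) \<partial>noise \<partial>\<zeta>)"
    by (subst noise.nn_integral_fst[symmetric]) auto
  finally show ?thesis .
qed

lemma nn_integral_noise_fst:
  fixes f :: "'a \<Rightarrow> ennreal"
  assumes [measurable]: "f \<in> borel_measurable borel"
  shows "(\<integral>\<^sup>+w. f (fst w) \<partial>noise) = (\<integral>\<^sup>+z. f z \<partial>std_gaussian)"
  using unif.emeasure_space_1 by (subst unif.nn_integral_fst[symmetric]) auto

lemma joint_step_snd:
  assumes "sets \<zeta> = sets (borel \<Otimes>\<^sub>M borel)" "distr \<zeta> borel snd = gibbs U"
  shows "distr (joint_step s \<zeta>) borel snd = gibbs U"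
proof (rule distr_eqI_nn_integral)
  fix A :: "'a set" assume [measurable]: "A \<in> sets borel"
  interpret noise: prob_space "noise :: ('a \<times> real) measure" by (rule prob_space_noise)
  have "(\<integral>\<^sup>+q. indicator A (snd q) \<partial>joint_step s \<zeta>)
      = (\<integral>\<^sup>+q. \<integral>\<^sup>+w. indicator A (rwm s (snd q) w) \<partial>noise \<partial>\<zeta>)"
    using assms by (subst nn_integral_joint_step) auto
  also have "\<dots> = (\<integral>\<^sup>+y. \<integral>\<^sup>+w. indicator A (rwm s y w) \<partial>noise \<partial>gibbs U)"
    by (rule nn_integral_snd_eq_marginal[OF assms(2,1)]) measurable
  also have "\<dots> = (\<integral>\<^sup>+y. indicator A y \<partial>gibbs U)"
    by (rule rwm_invariant) measurable
  finally show "(\<integral>\<^sup>+q. indicator A (snd q) \<partial>joint_step s \<zeta>) = (\<integral>\<^sup>+y. indicator A y \<partial>gibbs U)" .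
qed (auto simp: joint_step_def)

text \<open>\<open>rwm_coupling\<close> integrated over the coupling. Terms in the second coordinate
  become Gibbs integrals because that marginal is stationary.\<close>

lemma joint_step_cost:
  assumes sets [measurable_cong]: "sets \<zeta> = sets (borel \<Otimes>\<^sub>M borel)"
    and snd: "distr \<zeta> borel snd = gibbs U" and s: "0 < s" "s \<le> 1"
  shows "transport_cost (joint_step s \<zeta>) + ennreal (s\<^sup>2) * (\<integral>\<^sup>+y. ennreal (V y) \<partial>gibbs U)
    \<le> transport_cost \<zeta> + ennreal (s\<^sup>2) * (\<integral>\<^sup>+q. ennreal (V (fst q)) \<partial>\<zeta>)
      + ennreal (s ^ 3) * (\<integral>\<^sup>+y. ennreal (rwm_error y) \<partial>gibbs U)"
proof -
  interpret noise: prob_space "noise :: ('a \<times> real) measure" by (rule prob_space_noise)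
  have gibbs_eq: "(\<integral>\<^sup>+y. ennreal (f y) \<partial>gibbs U) = (\<integral>\<^sup>+q. ennreal (f (snd q)) \<partial>\<zeta>)"
    if [measurable]: "f \<in> borel_measurable borel" for f :: "'a \<Rightarrow> real"
    by (rule nn_integral_snd_eq_marginal[OF snd sets, symmetric]) measurable
  have "transport_cost (joint_step s \<zeta>) + ennreal (s\<^sup>2) * (\<integral>\<^sup>+y. ennreal (V y) \<partial>gibbs U)
    = (\<integral>\<^sup>+q. (\<integral>\<^sup>+w. ennreal ((norm (fst q + s *\<^sub>R fst w - rwm s (snd q) w))\<^sup>2) \<partial>noise)
        + ennreal (s\<^sup>2) * ennreal (V (snd q)) \<partial>\<zeta>)"
    unfolding transport_cost_def
    by (simp add: nn_integral_joint_step[OF sets] nn_integral_add nn_integral_cmult gibbs_eq)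
  also have "\<dots> \<le> (\<integral>\<^sup>+q. ennreal ((norm (fst q - snd q))\<^sup>2) + ennreal (s\<^sup>2) * ennreal (V (fst q))
      + ennreal (s ^ 3) * ennreal (rwm_error (snd q)) \<partial>\<zeta>)"
    by (intro nn_integral_mono rwm_coupling s)
  also have "\<dots> = transport_cost \<zeta> + ennreal (s\<^sup>2) * (\<integral>\<^sup>+q. ennreal (V (fst q)) \<partial>\<zeta>)
      + ennreal (s ^ 3) * (\<integral>\<^sup>+y. ennreal (rwm_error y) \<partial>gibbs U)"
    unfolding transport_cost_def
    by (simp add: nn_integral_add nn_integral_cmult gibbs_eq)
  finally show ?thesis .
qed

text \<open>In the descent lemma the linear term has mean zero and the squared norm of the noise has
  mean \<open>DIM('a)\<close>.\<close>

lemma nn_integral_V_gaussian: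
  assumes s: "0 < s"
  shows "(\<integral>\<^sup>+z. ennreal (V (p + s *\<^sub>R z)) \<partial>std_gaussian) \<le> ennreal (V p) + ennreal (L * real DIM('a) * s\<^sup>2 / 2)"
proof -
  define B where "B z = V p + s * (gradU p \<bullet> z) + L / 2 * s\<^sup>2 * (norm z)\<^sup>2" for z
  have pt: "V (p + s *\<^sub>R z) \<le> B z" for z
    using U_le_quadratic[of "p + s *\<^sub>R z" p] by (simp add: V_def B_def power_mult_distrib)
  have B_nonneg: "0 \<le> B z" for z using order_trans[OF V_nonneg pt] .
  note int = integrable_std_gaussian_inner[of "gradU p"] integrable_std_gaussian_norm_power[of 2, where 'a='a]
  have "(\<integral>\<^sup>+z. ennreal (V (p + s *\<^sub>R z)) \<partial>std_gaussian) \<le> (\<integral>\<^sup>+z. ennreal (B z) \<partial>std_gaussian)"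
    using pt by (intro nn_integral_mono ennreal_leI)
  also have "\<dots> = ennreal (\<integral>z. B z \<partial>std_gaussian)"
    using int B_nonneg by (intro nn_integral_eq_integral) (auto simp: B_def[abs_def])
  also have "(\<integral>z. B z \<partial>std_gaussian) = V p + L * real DIM('a) * s\<^sup>2 / 2"
    unfolding B_def using int
    by (simp add: integral_std_gaussian_inner integral_std_gaussian_norm_square)
  finally show ?thesis using V_nonneg L_nonneg by simp
qed

lemma joint_step_V:
  assumes sets [measurable_cong]: "sets \<zeta> = sets (borel \<Otimes>\<^sub>M borel)"
    and mass: "emeasure \<zeta> (space \<zeta>) = 1" and s: "0 < s"
  shows "(\<integral>\<^sup>+q. ennreal (V (fst q)) \<partial>joint_step s \<zeta>)
    \<le> (\<integral>\<^sup>+q. ennreal (V (fst q)) \<partial>\<zeta>) + ennreal (L * real DIM('a) * s\<^sup>2 / 2)"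
proof -
  have "(\<integral>\<^sup>+q. ennreal (V (fst q)) \<partial>joint_step s \<zeta>)
    = (\<integral>\<^sup>+q. \<integral>\<^sup>+w. ennreal (V (fst q + s *\<^sub>R fst w)) \<partial>noise \<partial>\<zeta>)"
    by (subst nn_integral_joint_step[OF sets]) auto
  also have "\<dots> = (\<integral>\<^sup>+q. \<integral>\<^sup>+z. ennreal (V (fst q + s *\<^sub>R z)) \<partial>std_gaussian \<partial>\<zeta>)"
    by (intro nn_integral_cong nn_integral_noise_fst) measurable
  also have "\<dots> \<le> (\<integral>\<^sup>+q. ennreal (V (fst q)) + ennreal (L * real DIM('a) * s\<^sup>2 / 2) \<partial>\<zeta>)"
    by (intro nn_integral_mono nn_integral_V_gaussian s)
  also have "\<dots> = (\<integral>\<^sup>+q. ennreal (V (fst q)) \<partial>\<zeta>) + ennreal (L * real DIM('a) * s\<^sup>2 / 2)"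
    using mass by (simp add: nn_integral_add)
  finally show ?thesis .
qed

lemma sets_joint_chain:
  assumes "sets \<zeta> = sets (borel \<Otimes>\<^sub>M borel)"
  shows "sets ((joint_step s ^^ k) \<zeta>) = sets (borel \<Otimes>\<^sub>M borel)"
  using assms by (cases k) auto

lemma joint_chain_snd:
  assumes "sets \<zeta> = sets (borel \<Otimes>\<^sub>M borel)" "distr \<zeta> borel snd = gibbs U"
  shows "distr ((joint_step s ^^ k) \<zeta>) borel snd = gibbs U"
  by (induction k) (simp_all add: assms joint_step_snd sets_joint_chain)

text \<open>The first coordinate ignores acceptance, so its increments are independent Gaussians and
  their variances add. The count is \<open>Suc k\<close> because \<open>gaussian 0 0\<close> is the
  zero measure and not a point mass.\<close>

lemma joint_chain_fst:
  fixes f :: "'a \<Rightarrow> ennreal"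
  assumes sets: "sets \<zeta> = sets (borel \<Otimes>\<^sub>M borel)" and s: "0 < s"
    and "f \<in> borel_measurable borel"
  shows "(\<integral>\<^sup>+q. f (fst q) \<partial>(joint_step s ^^ Suc k) \<zeta>)
    = (\<integral>\<^sup>+q. \<integral>\<^sup>+z. f (fst q + z) \<partial>gaussian 0 (real (Suc k) * s\<^sup>2) \<partial>\<zeta>)"
  using assms(3)
proof (induction k arbitrary: f)
  have one_step: "(\<integral>\<^sup>+q. f (fst q) \<partial>joint_step s \<zeta>') = (\<integral>\<^sup>+q. \<integral>\<^sup>+z. f (fst q + z) \<partial>gaussian 0 (s\<^sup>2) \<partial>\<zeta>')"
    if [measurable_cong]: "sets \<zeta>' = sets (borel \<Otimes>\<^sub>M borel)" and [measurable]: "f \<in> borel_measurable borel"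
    for \<zeta>' :: "('a \<times> 'a) measure" and f :: "'a \<Rightarrow> ennreal"
  proof -
    have "(\<integral>\<^sup>+q. f (fst q) \<partial>joint_step s \<zeta>') = (\<integral>\<^sup>+q. \<integral>\<^sup>+w. f (fst q + s *\<^sub>R fst w) \<partial>noise \<partial>\<zeta>')"
      using that(1) by (subst nn_integral_joint_step) auto
    also have "\<dots> = (\<integral>\<^sup>+q. \<integral>\<^sup>+z. f (fst q + s *\<^sub>R z) \<partial>std_gaussian \<partial>\<zeta>')"
      by (intro nn_integral_cong nn_integral_noise_fst) measurable
    also have "\<dots> = (\<integral>\<^sup>+q. \<integral>\<^sup>+z. f (fst q + z) \<partial>gaussian 0 (s\<^sup>2) \<partial>\<zeta>')"
      using s by (intro nn_integral_cong nn_integral_gaussian_scale) measurable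
    finally show ?thesis .
  qed
  {
    case 0
    then show ?case using one_step[OF sets] by simp
  next
    case (Suc k)
    note [measurable] = Suc.prems
    interpret g: prob_space "gaussian (0::'a) (s\<^sup>2)"
      using s by (intro prob_space_gaussian) simp
    have "(\<integral>\<^sup>+q. f (fst q) \<partial>(joint_step s ^^ Suc (Suc k)) \<zeta>)
      = (\<integral>\<^sup>+q. (\<lambda>p. \<integral>\<^sup>+z. f (p + z) \<partial>gaussian 0 (s\<^sup>2)) (fst q) \<partial>(joint_step s ^^ Suc k) \<zeta>)"
      using one_step[of "(joint_step s ^^ Suc k) \<zeta>" f] sets_joint_chain[OF sets, where s=s and k="Suc k"] by simp
    also have "\<dots> = (\<integral>\<^sup>+q. \<integral>\<^sup>+y. \<integral>\<^sup>+z. f (fst q + y + z) \<partial>gaussian 0 (s\<^sup>2)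
        \<partial>gaussian 0 (real (Suc k) * s\<^sup>2) \<partial>\<zeta>)"
      by (rule Suc.IH) measurable
    also have "\<dots> = (\<integral>\<^sup>+q. \<integral>\<^sup>+z. f (fst q + z) \<partial>gaussian 0 (s\<^sup>2 + real (Suc k) * s\<^sup>2) \<partial>\<zeta>)"
    proof (intro nn_integral_cong)
      fix q :: "'a \<times> 'a"
      show "(\<integral>\<^sup>+y. \<integral>\<^sup>+z. f (fst q + y + z) \<partial>gaussian 0 (s\<^sup>2) \<partial>gaussian 0 (real (Suc k) * s\<^sup>2))
        = (\<integral>\<^sup>+z. f (fst q + z) \<partial>gaussian 0 (s\<^sup>2 + real (Suc k) * s\<^sup>2))"
        using nn_integral_gaussian_add[of "s\<^sup>2" "real (Suc k) * s\<^sup>2" "\<lambda>z. f (fst q + z)"] s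
        by (simp add: add.assoc)
    qed
    also have "s\<^sup>2 + real (Suc k) * s\<^sup>2 = real (Suc (Suc k)) * s\<^sup>2" by (simp add: algebra_simps)
    finally show ?case .
  }
qed

text \<open>Each increment raises the mean of \<open>V\<close> by at most
  \<open>L * DIM('a) * s\<^sup>2 / 2\<close>; weighted by \<open>s\<^sup>2\<close>, this is the
  growth \<open>2 * c\<close> of \<open>ennreal_iterate_le\<close> with
  \<open>c = L * DIM('a) * s ^ 4 / 4\<close>.\<close>

lemma joint_chain_cost:
  assumes sets: "sets \<zeta> = sets (borel \<Otimes>\<^sub>M borel)"
    and snd: "distr \<zeta> borel snd = gibbs U" and s: "0 < s" "s \<le> 1"
  shows "transport_cost ((joint_step s ^^ k) \<zeta>)
      + of_nat k * (ennreal (s\<^sup>2) * (\<integral>\<^sup>+y. ennreal (V y) \<partial>gibbs U))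
    \<le> transport_cost \<zeta> + of_nat k * (ennreal (s\<^sup>2) * (\<integral>\<^sup>+q. ennreal (V (fst q)) \<partial>\<zeta>))
      + ennreal (L * real DIM('a) * s ^ 4 / 4 * (real k)\<^sup>2)
      + of_nat k * (ennreal (s ^ 3) * (\<integral>\<^sup>+y. ennreal (rwm_error y) \<partial>gibbs U))"
proof -
  interpret gibbs: prob_space "gibbs U" by (rule prob_space_gibbs)
  let ?\<zeta> = "\<lambda>k. (joint_step s ^^ k) \<zeta>"
  have mass: "emeasure (?\<zeta> k) (space (?\<zeta> k)) = 1" for k
  proof -
    have [measurable_cong]: "sets (?\<zeta> k) = sets (borel \<Otimes>\<^sub>M borel)" by (rule sets_joint_chain[OF sets])
    have "emeasure (distr (?\<zeta> k) borel snd) UNIV = emeasure (?\<zeta> k) (space (?\<zeta> k))"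
      by (subst emeasure_distr) auto
    then show ?thesis
      using joint_chain_snd[OF sets snd, where s=s and k=k] gibbs.emeasure_space_1 by simp
  qed
  have "ennreal (s\<^sup>2) * (\<integral>\<^sup>+q. ennreal (V (fst q)) \<partial>?\<zeta> (Suc k))
    \<le> ennreal (s\<^sup>2) * (\<integral>\<^sup>+q. ennreal (V (fst q)) \<partial>?\<zeta> k) + ennreal (2 * (L * real DIM('a) * s ^ 4 / 4))" for k
  proof -
    have "ennreal (s\<^sup>2) * (\<integral>\<^sup>+q. ennreal (V (fst q)) \<partial>?\<zeta> (Suc k))
      \<le> ennreal (s\<^sup>2) * ((\<integral>\<^sup>+q. ennreal (V (fst q)) \<partial>?\<zeta> k) + ennreal (L * real DIM('a) * s\<^sup>2 / 2))"
      using joint_step_V[OF sets_joint_chain[OF sets] mass s(1)] by (intro mult_left_mono) auto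
    also have "\<dots> = ennreal (s\<^sup>2) * (\<integral>\<^sup>+q. ennreal (V (fst q)) \<partial>?\<zeta> k)
        + ennreal (s\<^sup>2 * (L * real DIM('a) * s\<^sup>2 / 2))"
      unfolding distrib_left using L_nonneg by (subst ennreal_mult) auto
    also have "s\<^sup>2 * (L * real DIM('a) * s\<^sup>2 / 2) = 2 * (L * real DIM('a) * s ^ 4 / 4)"
      by (simp add: power2_eq_square power4_eq_xxxx)
    finally show ?thesis .
  qed
  moreover have "transport_cost (?\<zeta> (Suc k)) + ennreal (s\<^sup>2) * (\<integral>\<^sup>+y. ennreal (V y) \<partial>gibbs U)
    \<le> transport_cost (?\<zeta> k) + ennreal (s\<^sup>2) * (\<integral>\<^sup>+q. ennreal (V (fst q)) \<partial>?\<zeta> k)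
      + ennreal (s ^ 3) * (\<integral>\<^sup>+y. ennreal (rwm_error y) \<partial>gibbs U)" for k
    using joint_step_cost[OF sets_joint_chain[OF sets] joint_chain_snd[OF sets snd] s] by simp
  ultimately show ?thesis
    using ennreal_iterate_le[of "\<lambda>k. transport_cost (?\<zeta> k)"
        "ennreal (s\<^sup>2) * (\<integral>\<^sup>+y. ennreal (V y) \<partial>gibbs U)"
        "\<lambda>k. ennreal (s\<^sup>2) * (\<integral>\<^sup>+q. ennreal (V (fst q)) \<partial>?\<zeta> k)"
        "ennreal (s ^ 3) * (\<integral>\<^sup>+y. ennreal (rwm_error y) \<partial>gibbs U)"
        "L * real DIM('a) * s ^ 4 / 4" k] L_nonneg by simp
qed

section \<open>One Langevin step against the Gibbs measure\<close>

lemma ula_step_coupling_approx: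
  assumes h: "0 < h" "L * h \<le> 1" "m * h \<le> 1"
    and coupling: "\<zeta> \<in> couplings \<mu> (gibbs U)" and mu: "sets \<mu> = sets borel"
    and N: "0 < N" "2 * h \<le> real N"
  shows "\<exists>\<zeta>'\<in>couplings (\<mu> \<bind> ula_step gradU h) (gibbs U).
    transport_cost \<zeta>' \<le> ennreal (1 - m * h) * transport_cost \<zeta> + ennreal (L * real DIM('a) * h\<^sup>2)
      + ennreal (2 * h * sqrt (2 * h / real N)) * (\<integral>\<^sup>+y. ennreal (rwm_error y) \<partial>gibbs U)"
proof -
  \<comment> \<open>\<open>N\<close> increments of this size have total variance
    \<open>2 * h\<close>, that of the Langevin step, and the accumulated error
    \<open>N * s ^ 3 = 2 * h * s\<close> vanishes for large \<open>N\<close>. The bound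
    \<open>2 * h \<le> real N\<close> is \<open>s \<le> 1\<close>.\<close>
  define s where "s = sqrt (2 * h / real N)"
  have s: "0 < s" "s \<le> 1" and s2: "real N * s\<^sup>2 = 2 * h"
    using h N by (auto simp: s_def)
  have sets_\<zeta> [measurable_cong]: "sets \<zeta> = sets (borel \<Otimes>\<^sub>M borel)"
    and fst_\<zeta>: "distr \<zeta> borel fst = \<mu>" and snd_\<zeta>: "distr \<zeta> borel snd = gibbs U"
    using coupling by (auto simp: couplings_def)
  \<comment> \<open>The gradient step moves the first coordinate only, so the second marginal stays
    stationary.\<close>
  define \<zeta>0 where "\<zeta>0 = distr \<zeta> (borel \<Otimes>\<^sub>M borel) (\<lambda>q. (fst q - h *\<^sub>R gradU (fst q), snd q))"
  have sets0: "sets \<zeta>0 = sets (borel \<Otimes>\<^sub>M borel)" by (simp add: \<zeta>0_def)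
  have snd0: "distr \<zeta>0 borel snd = gibbs U"
    unfolding \<zeta>0_def by (subst distr_distr) (auto simp: comp_def snd_\<zeta>)
  have int0: "(\<integral>\<^sup>+q. f q \<partial>\<zeta>0) = (\<integral>\<^sup>+q. f (fst q - h *\<^sub>R gradU (fst q), snd q) \<partial>\<zeta>)"
    if [measurable]: "f \<in> borel_measurable (borel \<Otimes>\<^sub>M borel)" for f
    unfolding \<zeta>0_def by (rule nn_integral_distr) measurable
  define v where "v = (\<integral>\<^sup>+y. ennreal (V y) \<partial>gibbs U)"
  define M where "M = (\<integral>\<^sup>+y. ennreal (rwm_error y) \<partial>gibbs U)"
  define b where "b = (\<integral>\<^sup>+q. ennreal (V (fst q)) \<partial>\<zeta>0)"
  let ?\<zeta>' = "(joint_step s ^^ N) \<zeta>0"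
  have sets': "sets ?\<zeta>' = sets (borel \<Otimes>\<^sub>M borel)" by (rule sets_joint_chain[OF sets0])
  note [measurable] = ula_step_measurable[OF h(1) gradU_measurable]
  have fst': "distr ?\<zeta>' borel fst = \<mu> \<bind> ula_step gradU h"
  proof (rule distr_eqI_nn_integral)
    have mu_space: "space \<mu> \<noteq> {}" using mu sets_eq_imp_space_eq[OF mu] by simp
    have kernel: "ula_step gradU h \<in> measurable \<mu> (subprob_algebra borel)"
      using measurable_cong_sets[OF mu refl] ula_step_measurable[OF h(1) gradU_measurable] by blast
    show "sets (\<mu> \<bind> ula_step gradU h) = sets borel"
      by (rule sets_bind[OF sets_kernel[OF kernel] mu_space])
    show "fst \<in> measurable ?\<zeta>' borel"
      using measurable_cong_sets[OF sets' refl] measurable_fst by blast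
    fix A :: "'a set" assume A [measurable]: "A \<in> sets borel"
    obtain k where k: "N = Suc k" using N(1) by (cases N) auto
    interpret g: prob_space "gaussian (0::'a) (2 * h)"
      using h by (intro prob_space_gaussian) simp
    have "(\<integral>\<^sup>+q. indicator A (fst q) \<partial>?\<zeta>') = (\<integral>\<^sup>+q. \<integral>\<^sup>+z. indicator A (fst q + z) \<partial>gaussian 0 (2 * h) \<partial>\<zeta>0)"
      using joint_chain_fst[OF sets0 s(1), of "indicator A" k] s2 unfolding k by simp
    also have "\<dots> = (\<integral>\<^sup>+q. \<integral>\<^sup>+z. indicator A (fst q - h *\<^sub>R gradU (fst q) + z) \<partial>gaussian 0 (2 * h) \<partial>\<zeta>)"
      by (subst int0) auto
    also have "\<dots> = (\<integral>\<^sup>+x. \<integral>\<^sup>+z. indicator A (x - h *\<^sub>R gradU x + z) \<partial>gaussian 0 (2 * h) \<partial>\<mu>)"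
      by (rule nn_integral_fst_eq_marginal[OF fst_\<zeta> sets_\<zeta>]) measurable
    also have "\<dots> = (\<integral>\<^sup>+x. \<integral>\<^sup>+y. indicator A y \<partial>ula_step gradU h x \<partial>\<mu>)"
      by (simp add: ula_step_def nn_integral_gaussian del: nn_integral_indicator)
    also have "\<dots> = (\<integral>\<^sup>+y. indicator A y \<partial>(\<mu> \<bind> ula_step gradU h))"
      by (rule nn_integral_bind[OF _ kernel, symmetric]) measurable
    finally show "(\<integral>\<^sup>+q. indicator A (fst q) \<partial>?\<zeta>') = (\<integral>\<^sup>+y. indicator A y \<partial>(\<mu> \<bind> ula_step gradU h))" .
  qed
  have "?\<zeta>' \<in> couplings (\<mu> \<bind> ula_step gradU h) (gibbs U)"
    using sets' fst' joint_chain_snd[OF sets0 snd0] by (simp add: couplings_def)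
  moreover have "transport_cost ?\<zeta>' \<le> ennreal (1 - m * h) * transport_cost \<zeta>
      + ennreal (L * real DIM('a) * h\<^sup>2) + ennreal (2 * h * s) * M"
  proof -
    have scale: "of_nat N * (ennreal (s\<^sup>2) * X) = ennreal (2 * h) * X" for X
      by (simp add: mult.assoc[symmetric] ennreal_of_nat_eq_real_of_nat s2 flip: ennreal_mult)
    have "real N * s ^ 3 = (real N * s\<^sup>2) * s" by (simp add: power2_eq_square power3_eq_cube)
    then have scale3: "of_nat N * (ennreal (s ^ 3) * X) = ennreal (2 * h * s) * X" for X
      using s s2 by (simp add: mult.assoc[symmetric] ennreal_of_nat_eq_real_of_nat flip: ennreal_mult)
    \<comment> \<open>Here \<open>N\<close> drops out: the growth of \<open>V\<close> along the
      increments contributes the bias \<open>L * DIM('a) * h\<^sup>2\<close>, however many there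
      are.\<close>
    have "s ^ 4 * (real N)\<^sup>2 = (real N * s\<^sup>2)\<^sup>2"
      by (simp add: power_mult_distrib mult.commute flip: power_mult)
    then have quad: "L * real DIM('a) * s ^ 4 / 4 * (real N)\<^sup>2 = L * real DIM('a) * h\<^sup>2"
      unfolding s2 by (simp add: power_mult_distrib)
    have chain: "transport_cost ?\<zeta>' + ennreal (2 * h) * v
      \<le> transport_cost \<zeta>0 + ennreal (2 * h) * b + ennreal (L * real DIM('a) * h\<^sup>2) + ennreal (2 * h * s) * M"
      using joint_chain_cost[OF sets0 snd0 s, of N]
      unfolding scale scale3 quad v_def[symmetric] M_def[symmetric] b_def[symmetric] .
    have "transport_cost \<zeta>0 + ennreal (2 * h) * b
      = (\<integral>\<^sup>+q. ennreal ((norm (fst q - h *\<^sub>R gradU (fst q) - snd q))\<^sup>2)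
          + ennreal (2 * h) * ennreal (V (fst q - h *\<^sub>R gradU (fst q))) \<partial>\<zeta>)"
      unfolding transport_cost_def b_def by (simp add: int0 nn_integral_add nn_integral_cmult)
    also have "\<dots> \<le> (\<integral>\<^sup>+q. ennreal (1 - m * h) * ennreal ((norm (fst q - snd q))\<^sup>2)
          + ennreal (2 * h) * ennreal (V (snd q)) \<partial>\<zeta>)"
      using gradient_step[OF h(1,2)] h V_nonneg
      by (intro nn_integral_mono) (simp add: ennreal_leI flip: ennreal_mult ennreal_plus)
    also have "\<dots> = ennreal (1 - m * h) * transport_cost \<zeta> + ennreal (2 * h) * v"
      unfolding transport_cost_def v_def
      using nn_integral_snd_eq_marginal[OF snd_\<zeta> sets_\<zeta>, of "\<lambda>y. ennreal (V y)"]
      by (simp add: nn_integral_add nn_integral_cmult)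
    finally have start: "transport_cost \<zeta>0 + ennreal (2 * h) * b
      \<le> ennreal (1 - m * h) * transport_cost \<zeta> + ennreal (2 * h) * v" .
    \<comment> \<open>Chaining the two bounds leaves the stationary energy
      \<open>ennreal (2 * h) * v\<close> on both sides, where its finiteness permits
      cancellation.\<close>
    have "ennreal (2 * h) * v + transport_cost ?\<zeta>'
      \<le> (transport_cost \<zeta>0 + ennreal (2 * h) * b) + (ennreal (L * real DIM('a) * h\<^sup>2) + ennreal (2 * h * s) * M)"
      using chain by (simp add: add_ac)
    also have "\<dots> \<le> (ennreal (1 - m * h) * transport_cost \<zeta> + ennreal (2 * h) * v)
        + (ennreal (L * real DIM('a) * h\<^sup>2) + ennreal (2 * h * s) * M)"
      by (intro add_right_mono start)
    also have "\<dots> = ennreal (2 * h) * v + (ennreal (1 - m * h) * transport_cost \<zeta>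
        + ennreal (L * real DIM('a) * h\<^sup>2) + ennreal (2 * h * s) * M)"
      by (simp add: add_ac)
    finally show ?thesis
      using gibbs_V_finite unfolding v_def[symmetric]
      by (subst (asm) ennreal_add_left_cancel_le) (auto simp: ennreal_mult_eq_top_iff)
  qed
  ultimately show ?thesis unfolding s_def M_def by blast
qed

text \<open>Taking \<open>N\<close> large pushes the Metropolis error below \<open>e\<close>. No
  limit coupling is constructed; the slack \<open>e\<close> stands in for it.\<close>

lemma ula_step_coupling:
  assumes h: "0 < h" "L * h \<le> 1" "m * h \<le> 1"
    and coupling: "\<zeta> \<in> couplings \<mu> (gibbs U)" and mu: "sets \<mu> = sets borel"
    and cost: "transport_cost \<zeta> \<le> ennreal C" "0 \<le> C" and e: "0 < e"
  shows "\<exists>\<zeta>'\<in>couplings (\<mu> \<bind> ula_step gradU h) (gibbs U).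
    transport_cost \<zeta>' \<le> ennreal ((1 - m * h) * C + L * real DIM('a) * h\<^sup>2 + e)"
proof -
  obtain M where M: "(\<integral>\<^sup>+y. ennreal (rwm_error y) \<partial>gibbs U) = ennreal M" "0 \<le> M"
    using gibbs_rwm_error_finite by (cases "\<integral>\<^sup>+y. ennreal (rwm_error y) \<partial>gibbs U") auto
  have "(\<lambda>N. 2 * h * sqrt (2 * h / real N) * M) \<longlonglongrightarrow> 2 * h * sqrt 0 * M"
    by (intro tendsto_intros tendsto_divide_0[OF tendsto_const] filterlim_real_sequentially
        filterlim_at_top_imp_at_infinity)
  then have "\<forall>\<^sub>F N in sequentially. 2 * h * sqrt (2 * h / real N) * M < e"
    using e by (intro order_tendstoD(2)) auto
  moreover have "\<forall>\<^sub>F N in sequentially. 2 * h \<le> real N"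
    using filterlim_real_sequentially by (simp add: filterlim_at_top)
  moreover have "\<forall>\<^sub>F N in sequentially. 0 < (N::nat)" by (rule eventually_gt_at_top)
  ultimately have "\<forall>\<^sub>F N in sequentially. 2 * h * sqrt (2 * h / real N) * M < e \<and> 2 * h \<le> real N \<and> 0 < N"
    by eventually_elim simp
  from eventually_happens'[OF sequentially_bot this]
  obtain N where N: "2 * h * sqrt (2 * h / real N) * M < e" "2 * h \<le> real N" "0 < N" by blast
  obtain \<zeta>' where \<zeta>': "\<zeta>' \<in> couplings (\<mu> \<bind> ula_step gradU h) (gibbs U)"
    "transport_cost \<zeta>' \<le> ennreal (1 - m * h) * transport_cost \<zeta> + ennreal (L * real DIM('a) * h\<^sup>2)
      + ennreal (2 * h * sqrt (2 * h / real N)) * ennreal M"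
    using ula_step_coupling_approx[OF h coupling mu N(3,2)] unfolding M by blast
  note \<zeta>'(2)
  also have "ennreal (1 - m * h) * transport_cost \<zeta> + ennreal (L * real DIM('a) * h\<^sup>2)
      + ennreal (2 * h * sqrt (2 * h / real N)) * ennreal M
    \<le> ennreal (1 - m * h) * ennreal C + ennreal (L * real DIM('a) * h\<^sup>2) + ennreal e"
    using N(1) M(2) h cost by (intro add_mono mult_left_mono order_refl) (auto simp flip: ennreal_mult intro!: ennreal_leI)
  also have "\<dots> = ennreal ((1 - m * h) * C + L * real DIM('a) * h\<^sup>2 + e)"
    using h cost(2) e L_nonneg by (simp flip: ennreal_mult ennreal_plus)
  finally show ?thesis using \<zeta>'(1) by blast
qed

text \<open>The product coupling, with the squared distance split at the minimizer and the second
  moment bound \<open>d / m\<close>. The splitting produces the factor 2 in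
  \<open>u1\<close>.\<close>

lemma dirac_coupling:
  "\<exists>\<zeta>\<in>couplings (return borel x) (gibbs U).
    transport_cost \<zeta> \<le> ennreal (2 * ((norm (x - minimizer U))\<^sup>2 + real DIM('a) / m))"
proof -
  interpret gibbs: prob_space "gibbs U" by (rule prob_space_gibbs)
  define \<zeta> where "\<zeta> = distr (gibbs U) (borel \<Otimes>\<^sub>M borel) (\<lambda>y. (x, y))"
  have "distr \<zeta> borel fst = return borel x"
    unfolding \<zeta>_def by (subst distr_distr) (auto simp: comp_def)
  moreover have "distr \<zeta> borel snd = gibbs U"
    unfolding \<zeta>_def by (subst distr_distr) (auto simp: comp_def intro!: distr_id2)
  ultimately have "\<zeta> \<in> couplings (return borel x) (gibbs U)"
    by (simp add: couplings_def \<zeta>_def)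
  moreover have "transport_cost \<zeta> \<le> ennreal (2 * ((norm (x - minimizer U))\<^sup>2 + real DIM('a) / m))"
  proof -
    have "transport_cost \<zeta> = (\<integral>\<^sup>+y. ennreal ((norm (x - y))\<^sup>2) \<partial>gibbs U)"
      unfolding transport_cost_def \<zeta>_def by (subst nn_integral_distr) auto
    also have "\<dots> \<le> (\<integral>\<^sup>+y. ennreal (2 * (norm (x - minimizer U))\<^sup>2) + 2 * ennreal ((norm (y - minimizer U))\<^sup>2) \<partial>gibbs U)"
    proof (intro nn_integral_mono)
      fix y
      define a b where "a = norm (x - minimizer U)" and "b = norm (y - minimizer U)"
      have "norm (x - y) \<le> a + b"
        using norm_triangle_ineq4[of "x - minimizer U" "y - minimizer U"] by (simp add: a_def b_def)
      then have "(norm (x - y))\<^sup>2 \<le> (a + b)\<^sup>2" by (intro power_mono) auto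
      also have "\<dots> \<le> 2 * a\<^sup>2 + 2 * b\<^sup>2" using sum_squares_bound[of a b] by (simp add: power2_sum)
      finally have "ennreal ((norm (x - y))\<^sup>2) \<le> ennreal (2 * a\<^sup>2 + 2 * b\<^sup>2)" by (rule ennreal_leI)
      also have "\<dots> = ennreal (2 * a\<^sup>2) + 2 * ennreal (b\<^sup>2)"
        by (simp add: ennreal_mult flip: ennreal_numeral)
      finally show "ennreal ((norm (x - y))\<^sup>2) \<le> ennreal (2 * (norm (x - minimizer U))\<^sup>2)
          + 2 * ennreal ((norm (y - minimizer U))\<^sup>2)" unfolding a_def b_def .
    qed
    also have "\<dots> = ennreal (2 * (norm (x - minimizer U))\<^sup>2)
        + 2 * (\<integral>\<^sup>+y. ennreal ((norm (y - minimizer U))\<^sup>2) \<partial>gibbs U)"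
      using gibbs.emeasure_space_1 by (simp add: nn_integral_add nn_integral_cmult)
    also have "\<dots> \<le> ennreal (2 * (norm (x - minimizer U))\<^sup>2) + 2 * ennreal (real DIM('a) / m)"
      by (intro add_mono mult_left_mono gibbs_second_moment) auto
    also have "2 * ennreal (real DIM('a) / m) = ennreal (2 * (real DIM('a) / m))"
      using m_pos by (subst ennreal_mult) auto
    also have "ennreal (2 * (norm (x - minimizer U))\<^sup>2) + ennreal (2 * (real DIM('a) / m))
      = ennreal (2 * ((norm (x - minimizer U))\<^sup>2 + real DIM('a) / m))"
      using m_pos by (simp add: distrib_left)
    finally show ?thesis .
  qed
  ultimately show ?thesis by blast
qed

end

section \<open>Comparison with the explicit bound\<close>

lemma u2_Suc:
  "u2 d m L \<gamma> (Suc n) = (1 - kappa m L * \<gamma> (Suc n) / 2) * u2 d m L \<gamma> n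
    + L\<^sup>2 * real d * ((\<gamma> (Suc n))\<^sup>2 * (inverse (kappa m L) + \<gamma> (Suc n)) *
        (2 + L\<^sup>2 * \<gamma> (Suc n) / m + L\<^sup>2 * (\<gamma> (Suc n))\<^sup>2 / 6))"
proof -
  define t where "t i = (\<gamma> i)\<^sup>2 * (inverse (kappa m L) + \<gamma> i) * (2 + L\<^sup>2 * \<gamma> i / m + L\<^sup>2 * (\<gamma> i)\<^sup>2 / 6)" for i
  define r where "r k = 1 - kappa m L * \<gamma> k / 2" for k
  \<comment> \<open>The new index carries an empty product; all earlier products gain the factor
    \<open>r (Suc n)\<close>.\<close>
  have "(\<Sum>i=1..Suc n. t i * (\<Prod>k=i+1..Suc n. r k)) = (\<Sum>i=1..n. t i * (\<Prod>k=i+1..Suc n. r k)) + t (Suc n)"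
    by simp
  also have "(\<Sum>i=1..n. t i * (\<Prod>k=i+1..Suc n. r k)) = (\<Sum>i=1..n. r (Suc n) * (t i * (\<Prod>k=i+1..n. r k)))"
    by (intro sum.cong) (auto simp: mult_ac)
  also have "\<dots> = r (Suc n) * (\<Sum>i=1..n. t i * (\<Prod>k=i+1..n. r k))"
    by (simp only: sum_distrib_left)
  finally have sum_Suc: "(\<Sum>i=1..Suc n. t i * (\<Prod>k=i+1..Suc n. r k))
      = r (Suc n) * (\<Sum>i=1..n. t i * (\<Prod>k=i+1..n. r k)) + t (Suc n)" .
  show ?thesis
    unfolding u2_def t_def[symmetric] r_def[symmetric] sum_Suc by (simp only: algebra_simps)
qed

text \<open>For positive \<open>L\<close>, \<open>2 / kappa m L = (m + L) / (m * L)\<close> is at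
  least \<open>1 / L\<close>, and the remaining summands are nonnegative. For \<open>L = 0\<close>
  the inverse of \<open>kappa\<close> is the default 0, and both sides vanish through their factor
  \<open>L\<close>.\<close>

lemma step_error_le_u2_term:
  fixes L m h d :: real
  assumes "0 \<le> L" "0 < m" "0 < h" and d: "0 \<le> d"
  shows "L * d * h\<^sup>2 \<le> L\<^sup>2 * d * (h\<^sup>2 * (inverse (kappa m L) + h) * (2 + L\<^sup>2 * h / m + L\<^sup>2 * h\<^sup>2 / 6))"
proof (cases "L = 0")
  case False
  with assms have L: "0 < L" by simp
  have "L * m \<le> L * (m + L)" using L by simp
  also have "\<dots> = L\<^sup>2 * (inverse (kappa m L) * 2) * m"
    using L assms by (simp add: kappa_def field_simps power2_eq_square)
  finally have "L \<le> L\<^sup>2 * (inverse (kappa m L) * 2)" using assms by simp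
  also have "\<dots> \<le> L\<^sup>2 * ((inverse (kappa m L) + h) * (2 + L\<^sup>2 * h / m + L\<^sup>2 * h\<^sup>2 / 6))"
    using L assms by (intro mult_left_mono mult_mono) (auto simp: kappa_def)
  finally have "L * (d * h\<^sup>2) \<le> L\<^sup>2 * ((inverse (kappa m L) + h) * (2 + L\<^sup>2 * h / m + L\<^sup>2 * h\<^sup>2 / 6)) * (d * h\<^sup>2)"
    using d by (intro mult_right_mono) auto
  then show ?thesis by (simp only: mult_ac)
qed simp

theorem theorem5:
  fixes U :: "'a::euclidean_space \<Rightarrow> real" and gradU :: "'a \<Rightarrow> 'a"
    and L m :: real and \<gamma> :: "nat \<Rightarrow> real" and x :: 'a and n :: nat
  assumes gradient: "\<And>y. GDERIV U y :> gradU y"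
    and gradient_continuous: "continuous_on UNIV gradU"
    and L_nonneg: "L \<ge> 0" and m_pos: "m > 0"
    and lipschitz: "\<And>y z. norm (gradU y - gradU z) \<le> L * norm (y - z)"
    and strongly_convex:
      "\<And>y z. U z \<ge> U y + inner (gradU y) (z - y) + m / 2 * (norm (y - z))\<^sup>2"
    and step_pos: "\<And>k. k \<ge> 1 \<Longrightarrow> \<gamma> k > 0"
    and step_antimono: "antimono_on {1..} \<gamma>"
    and step_bound: "\<gamma> 1 \<le> 1 / (m + L)"
    and n_ge_1: "n \<ge> 1"
  shows "(wasserstein2 (return borel x \<bind> ula_kernel gradU \<gamma> n) (gibbs U))\<^sup>2
    \<le> ennreal (u1 m L \<gamma> n * ((norm (x - minimizer U))\<^sup>2 + real DIM('a) / m)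
                + u2 DIM('a) m L \<gamma> n)"
proof -
  interpret strongly_convex_potential U gradU L m
    by (unfold_locales; fact)
  define C where "C = 2 * ((norm (x - minimizer U))\<^sup>2 + real DIM('a) / m)"
  \<comment> \<open>The claimed bound, with the factor 2 of \<open>u1\<close> moved into
    \<open>C\<close>; for \<open>n = 0\<close> it equals \<open>C\<close>, the cost of the initial
    coupling.\<close>
  define R where "R n = (\<Prod>k=1..n. 1 - kappa m L * \<gamma> k / 2) * C + u2 DIM('a) m L \<gamma> n" for n
  have C: "0 \<le> C" using m_pos by (simp add: C_def)
  have kernel: "ula_kernel gradU \<gamma> n \<in> measurable borel (subprob_algebra borel)" for n
    by (rule ula_kernel_measurable[OF step_pos gradU_measurable])
  \<comment> \<open>Every step is at most \<open>1 / (m + L)\<close>, so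
    \<open>m * \<gamma> k + L * \<gamma> k\<close> is at most 1, which covers both restrictions on
    the step. The last bound holds since \<open>kappa m L / 2\<close> is \<open>m\<close> times
    \<open>L / (m + L)\<close>.\<close>
  have step: "m * \<gamma> k \<le> 1" "L * \<gamma> k \<le> 1" "kappa m L * \<gamma> k / 2 \<le> m * \<gamma> k" if k: "k \<ge> 1" for k
  proof -
    have "\<gamma> k \<le> \<gamma> 1" using monotone_onD[OF step_antimono, of 1 k] k by simp
    then have "\<gamma> k \<le> 1 / (m + L)" using step_bound by simp
    then have "m * \<gamma> k + L * \<gamma> k \<le> 1"
      using m_pos L_nonneg by (simp add: field_simps)
    moreover have "0 \<le> m * \<gamma> k" "0 \<le> L * \<gamma> k" using step_pos[OF k] m_pos L_nonneg by simp_all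
    ultimately show "m * \<gamma> k \<le> 1" "L * \<gamma> k \<le> 1" by linarith+
    have kappa: "kappa m L = 2 * (m * (L / (m + L)))" by (simp only: kappa_def times_divide_eq_right mult.assoc)
    have "kappa m L / 2 = m * (L / (m + L))"
      unfolding kappa by (rule nonzero_mult_div_cancel_left) simp
    also have "\<dots> \<le> m * 1" using m_pos L_nonneg by (intro mult_left_mono) auto
    finally show "kappa m L * \<gamma> k / 2 \<le> m * \<gamma> k"
      using mult_right_mono[of "kappa m L / 2" m "\<gamma> k"] step_pos[OF k] by simp
  qed
  \<comment> \<open>The claimed bound contracts at the slower rate \<open>kappa m L / 2\<close> and
    adds a larger error per step, so it dominates the recursion proved for the couplings. Comparing
    the rates requires \<open>R n\<close> to be nonnegative.\<close>
  have R_Suc: "(1 - m * \<gamma> (Suc n)) * R n + L * real DIM('a) * (\<gamma> (Suc n))\<^sup>2 \<le> R (Suc n)"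
    if "0 \<le> R n" for n
  proof -
    have "(1 - m * \<gamma> (Suc n)) * R n \<le> (1 - kappa m L * \<gamma> (Suc n) / 2) * R n"
      using step(3)[of "Suc n"] that by (intro mult_right_mono) auto
    moreover have "L * real DIM('a) * (\<gamma> (Suc n))\<^sup>2 \<le> L\<^sup>2 * real DIM('a) *
        ((\<gamma> (Suc n))\<^sup>2 * (inverse (kappa m L) + \<gamma> (Suc n)) *
          (2 + L\<^sup>2 * \<gamma> (Suc n) / m + L\<^sup>2 * (\<gamma> (Suc n))\<^sup>2 / 6))"
      using step_pos[of "Suc n"] by (intro step_error_le_u2_term L_nonneg m_pos) auto
    moreover have R_eq: "R (Suc n) = (1 - kappa m L * \<gamma> (Suc n) / 2) * R n + L\<^sup>2 * real DIM('a) *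
        ((\<gamma> (Suc n))\<^sup>2 * (inverse (kappa m L) + \<gamma> (Suc n)) *
          (2 + L\<^sup>2 * \<gamma> (Suc n) / m + L\<^sup>2 * (\<gamma> (Suc n))\<^sup>2 / 6))"
      by (simp add: R_def u2_Suc distrib_left mult_ac)
    ultimately show ?thesis unfolding R_eq by (intro add_mono)
  qed
  have R_nonneg: "0 \<le> R n" for n
  proof (induction n)
    case 0
    then show ?case using C by (simp add: R_def u2_def)
  next
    case (Suc n)
    have "0 \<le> (1 - m * \<gamma> (Suc n)) * R n + L * real DIM('a) * (\<gamma> (Suc n))\<^sup>2"
      using Suc step(1)[of "Suc n"] L_nonneg by simp
    with R_Suc[OF Suc] show ?case by simp
  qed
  \<comment> \<open>The slack is arbitrary in the induction: half of it goes to the previous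
    coupling, where the factor \<open>1 - m * \<gamma> (Suc n)\<close> does not enlarge it, and half
    to the new step.\<close>
  have coupling: "\<exists>\<zeta>\<in>couplings (ula_kernel gradU \<gamma> n x) (gibbs U). transport_cost \<zeta> \<le> ennreal (R n + e)"
    if "0 < e" for n e
    using that
  proof (induction n arbitrary: e)
    case 0
    have "ennreal C \<le> ennreal (R 0 + e)" using 0 by (intro ennreal_leI) (simp add: R_def u2_def)
    then show ?case
      using dirac_coupling[of x] unfolding C_def[symmetric] by (auto intro: order_trans)
  next
    case (Suc n)
    have h: "0 < \<gamma> (Suc n)" by (rule step_pos) simp
    obtain \<zeta> where \<zeta>: "\<zeta> \<in> couplings (ula_kernel gradU \<gamma> n x) (gibbs U)"
      "transport_cost \<zeta> \<le> ennreal (R n + e / 2)"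
      using Suc.IH[of "e / 2"] Suc.prems by auto
    have "sets (ula_kernel gradU \<gamma> n x) = sets borel"
      using sets_kernel[OF kernel, of x] by simp
    then obtain \<zeta>' where \<zeta>': "\<zeta>' \<in> couplings (ula_kernel gradU \<gamma> (Suc n) x) (gibbs U)"
      "transport_cost \<zeta>' \<le> ennreal ((1 - m * \<gamma> (Suc n)) * (R n + e / 2)
        + L * real DIM('a) * (\<gamma> (Suc n))\<^sup>2 + e / 2)"
      using ula_step_coupling[OF h step(2,1) \<zeta>(1) _ \<zeta>(2), of "e / 2"] R_nonneg[of n] Suc.prems by auto
    note \<zeta>'(2)
    also have "(1 - m * \<gamma> (Suc n)) * (R n + e / 2) + L * real DIM('a) * (\<gamma> (Suc n))\<^sup>2 + e / 2
      \<le> R (Suc n) + e"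
    proof -
      have "0 \<le> m * \<gamma> (Suc n)" using m_pos h by simp
      then have "(1 - m * \<gamma> (Suc n)) * (e / 2) \<le> e / 2"
        using Suc.prems by (intro mult_left_le_one_le) (use step(1)[of "Suc n"] in auto)
      then show ?thesis using R_Suc[OF R_nonneg, of n] by (simp only: distrib_left)
    qed
    then have "ennreal ((1 - m * \<gamma> (Suc n)) * (R n + e / 2) + L * real DIM('a) * (\<gamma> (Suc n))\<^sup>2 + e / 2)
      \<le> ennreal (R (Suc n) + e)" by (rule ennreal_leI)
    finally show ?case using \<zeta>'(1) by blast
  qed
  have "(wasserstein2 (ula_kernel gradU \<gamma> n x) (gibbs U))\<^sup>2 \<le> ennreal (R n)"
  proof (rule ennreal_le_epsilon)
    fix e :: real assume e: "0 < e"
    then obtain \<zeta> where \<zeta>: "\<zeta> \<in> couplings (ula_kernel gradU \<gamma> n x) (gibbs U)"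
      "transport_cost \<zeta> \<le> ennreal (R n + e)"
      using coupling by blast
    have "(wasserstein2 (ula_kernel gradU \<gamma> n x) (gibbs U))\<^sup>2 \<le> ennreal (R n + e)"
      using wasserstein2_square_le[OF \<zeta>(1)] \<zeta>(2) by (rule order_trans)
    then show "(wasserstein2 (ula_kernel gradU \<gamma> n x) (gibbs U))\<^sup>2 \<le> ennreal (R n) + ennreal e"
      using R_nonneg e by simp
  qed
  moreover have "return borel x \<bind> ula_kernel gradU \<gamma> n = ula_kernel gradU \<gamma> n x"
    by (rule bind_return[OF kernel]) simp
  moreover have "R n = u1 m L \<gamma> n * ((norm (x - minimizer U))\<^sup>2 + real DIM('a) / m) + u2 DIM('a) m L \<gamma> n"
    by (simp add: R_def C_def u1_def)
  ultimately show ?thesis by simp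
qed

end
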